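(* Let $X$ be a Bousfield-Segal space. The family of sets $\mathrm{Ho}_B(X)=(\pi_0X_1(x,y)\mid (x,y)\in X_{00}\times X_{00})$ together with the operation $\circ$ defined as the composite $$\mathrm{Ho}_B(X)(y,z)\times\mathrm{Ho}_B(X)(x,y)\to\mathrm{Ho}_B(X)(y,z)\times\mathrm{Ho}_B(X)(y,x)\to\mathrm{Ho}_B(X)(x,z),$$ $$([g],[f])\mapsto[g]/([1_x]/[f])=[g/(1_x/f)],$$ is a groupoid.
   Context: For a bisimplicial set $X\colon\Delta^{op}\times\Delta^{op}\to\mathrm{Set}$, $X_{nm}=X([n],[m])$, write $X_n=X_{n\bullet}$ for the $n$-th column, a simplicial set; $d_i,s_i$ denote the horizontal structure maps between columns. $X$ is $v$-fibrant if it is fibrant in the Reedy (equivalently injective) model structure on simplicial objects $n\mapsto X_n$ in simplicial sets with the Kan-Quillen model structure. For a simplicial set $A$, $A\setminus X$ is the simplicial set with $(A\setminus X)_m=\mathrm{Hom}(A\mathbin{\Box}\Delta^m,X)$, where $(A\mathbin{\Box}B)_{nm}=A_n\times B_m$; thus $\Delta^n\setminus X\cong X_n$. Let $c_n\colon C_n\hookrightarrow\Delta^n$ be the inclusion of the union of the edges $\{0,i\}$, $0<i\le n$. A $v$-fibrant $X$ is a Bousfield-Segal space if the Bousfield maps $\beta_n=c_n\setminus X\colon X_n\to C_n\setminus X=X_1\times^B_{X_0}\dots\times^B_{X_0}X_1$ ($n$-fold fibre product along $d_1$) are weak homotopy equivalences for all $n\ge 2$. For vertices $x,y\in X_{00}$,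 $X_1(x,y)$ is the fibre of $(d_1,d_0)\colon X_1\to X_0\times X_0$ over $(x,y)$, and $1_x:=s_0x$. Let $\mu_2$ be a section of the acyclic fibration $\beta_2\colon X_2\to X_1\times^B_{X_0}X_1$, $\sigma\mapsto(d_1\sigma,d_2\sigma)$. The fraction operation is $f/g:=d_0\mu_2(f,g)$; it restricts to maps $X_1(x,y)\times X_1(x,z)\to X_1(z,y)$, $(f,g)\mapsto f/g$, and descends to $\pi_0$ via $[f]/[g]:=[f/g]$. *)

theory Defs
  imports "HOL-Library.FuncSet"
begin

section \<open>The simplex category\<close>

text \<open>
  The monotone maps \<open>[m] \<rightarrow> [n]\<close>, where \<open>[n] = {0, \<dots>, n}\<close>. They are extensional functions, so that
  equality of morphisms is equality in HOL; the composite of \<open>\<phi> : [k] \<rightarrow> [m]\<close> and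
  \<open>\<theta> : [m] \<rightarrow> [n]\<close> is \<open>compose {..k} \<theta> \<phi>\<close>.
\<close>

definition ord_maps :: "nat \<Rightarrow> nat \<Rightarrow> (nat \<Rightarrow> nat) set" where
  "ord_maps m n = {\<theta> \<in> {..m} \<rightarrow>\<^sub>E {..n}. mono_on {..m} \<theta>}"

definition ord_id :: "nat \<Rightarrow> nat \<Rightarrow> nat" where
  "ord_id n = (\<lambda>j\<in>{..n}. j)"

text \<open>
  \<open>coface n i : [n-1] \<rightarrow> [n]\<close> omits \<open>i\<close> (for \<open>n \<ge> 1\<close>), and \<open>codegen n i : [n+1] \<rightarrow> [n]\<close> hits \<open>i\<close> twice.
\<close>

definition coface :: "nat \<Rightarrow> nat \<Rightarrow> nat \<Rightarrow> nat" where
  "coface n i = (\<lambda>j\<in>{..n - 1}. if j < i then j else Suc j)"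

definition codegen :: "nat \<Rightarrow> nat \<Rightarrow> nat \<Rightarrow> nat" where
  "codegen n i = (\<lambda>j\<in>{..Suc n}. if j \<le> i then j else j - 1)"

lemma ord_id_in: "ord_id n \<in> ord_maps n n"
  by (auto simp: ord_maps_def ord_id_def mono_on_def)

lemma ord_comp_in: "\<phi> \<in> ord_maps k m \<Longrightarrow> \<theta> \<in> ord_maps m n \<Longrightarrow> compose {..k} \<theta> \<phi> \<in> ord_maps k n"
  by (auto simp: ord_maps_def mono_on_def compose_def PiE_iff Pi_iff)

lemma ord_comp_id_right: "\<theta> \<in> ord_maps m n \<Longrightarrow> compose {..m} \<theta> (ord_id m) = \<theta>"
  by (auto simp: ord_maps_def ord_id_def compose_def PiE_iff extensional_def fun_eq_iff)

lemma ord_comp_id_left: "\<theta> \<in> ord_maps m n \<Longrightarrow> compose {..m} (ord_id n) \<theta> = \<theta>"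
  by (auto simp: ord_maps_def ord_id_def compose_def PiE_iff extensional_def fun_eq_iff Pi_iff)

lemma ord_comp_assoc: "\<phi> \<in> ord_maps k m \<Longrightarrow> compose {..k} \<psi> (compose {..k} \<theta> \<phi>) = compose {..k} (compose {..m} \<psi> \<theta>) \<phi>"
  by (auto simp: ord_maps_def compose_def PiE_iff Pi_iff fun_eq_iff)

lemma coface_in: "1 \<le> n \<Longrightarrow> i \<le> n \<Longrightarrow> coface n i \<in> ord_maps (n-1) n"
  by (auto simp: ord_maps_def coface_def mono_on_def)

lemma codegen_in: "i \<le> n \<Longrightarrow> codegen n i \<in> ord_maps (Suc n) n"
  by (auto simp: ord_maps_def codegen_def mono_on_def)

section \<open>Simplicial sets\<close>

text \<open>
  \<open>act A m n \<theta> : A\<^sub>n \<rightarrow> A\<^sub>m\<close> is the action of \<open>\<theta> : [m] \<rightarrow> [n]\<close>. Its values off the carriers are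
  irrelevant.
\<close>

record 'a sset =
  cells :: "nat \<Rightarrow> 'a set"
  act :: "nat \<Rightarrow> nat \<Rightarrow> (nat \<Rightarrow> nat) \<Rightarrow> 'a \<Rightarrow> 'a"

definition simplicial_set :: "'a sset \<Rightarrow> bool" where
  "simplicial_set A \<longleftrightarrow>
     (\<forall>m n. \<forall>\<theta>\<in>ord_maps m n. \<forall>a\<in>cells A n. act A m n \<theta> a \<in> cells A m) \<and>
     (\<forall>n. \<forall>a\<in>cells A n. act A n n (ord_id n) a = a) \<and>
     (\<forall>k m n. \<forall>\<phi>\<in>ord_maps k m. \<forall>\<theta>\<in>ord_maps m n. \<forall>a\<in>cells A n.
        act A k n (compose {..k} \<theta> \<phi>) a = act A k m \<phi> (act A m n \<theta> a))"

definition simplicial_map :: "'a sset \<Rightarrow> 'b sset \<Rightarrow> (nat \<Rightarrow> 'a \<Rightarrow> 'b) \<Rightarrow> bool" where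
  "simplicial_map A B f \<longleftrightarrow>
     (\<forall>n. f n \<in> cells A n \<rightarrow> cells B n) \<and>
     (\<forall>m n. \<forall>\<theta>\<in>ord_maps m n. \<forall>a\<in>cells A n. f m (act A m n \<theta> a) = act B m n \<theta> (f n a))"

text \<open>\<open>face A n i\<close> is \<open>d\<^sub>i : A\<^sub>n \<rightarrow> A\<^bsub>n-1\<^esub>\<close>, for \<open>n \<ge> 1\<close>.\<close>

definition face :: "'a sset \<Rightarrow> nat \<Rightarrow> nat \<Rightarrow> 'a \<Rightarrow> 'a" where
  "face A n i = act A (n - 1) n (coface n i)"

text \<open>The \<open>m\<close>-simplex that is constant at the vertex \<open>v\<close>.\<close>

definition const_cell :: "'a sset \<Rightarrow> nat \<Rightarrow> 'a \<Rightarrow> 'a" where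
  "const_cell A m v = act A m 0 (\<lambda>j\<in>{..m}. 0) v"

definition std_simplex :: "nat \<Rightarrow> (nat \<Rightarrow> nat) sset" where
  "std_simplex n = \<lparr>cells = (\<lambda>m. ord_maps m n), act = (\<lambda>l m \<phi> \<theta>. compose {..l} \<theta> \<phi>)\<rparr>"

definition simplex_boundary :: "nat \<Rightarrow> (nat \<Rightarrow> nat) sset" where
  "simplex_boundary n =
     (std_simplex n)\<lparr>cells := (\<lambda>m. {\<theta> \<in> ord_maps m n. \<theta> ` {..m} \<noteq> {..n}})\<rparr>"

text \<open>\<open>C\<^sub>n \<subseteq> \<Delta>\<^sup>n\<close>, the union of the edges \<open>{0, i}\<close> with \<open>0 < i \<le> n\<close>.\<close>

definition star_edges :: "nat \<Rightarrow> (nat \<Rightarrow> nat) sset" where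
  "star_edges n =
     (std_simplex n)\<lparr>cells := (\<lambda>m. {\<theta> \<in> ord_maps m n. \<exists>i. 0 < i \<and> i \<le> n \<and> \<theta> ` {..m} \<subseteq> {0, i}})\<rparr>"

section \<open>The Kan-Quillen model structure\<close>

text \<open>
  The right lifting property of \<open>p : E \<rightarrow> B\<close> against the horn inclusions \<open>\<Lambda>\<^sup>n\<^sub>k \<subseteq> \<Delta>\<^sup>n\<close>, \<open>n \<ge> 1\<close>. A map
  \<open>\<Lambda>\<^sup>n\<^sub>k \<rightarrow> E\<close> is given by its values \<open>x i\<close> on the faces \<open>i \<noteq> k\<close>, subject to \<open>d\<^sub>i x\<^sub>j = d\<^bsub>j-1\<^esub> x\<^sub>i\<close> for
  \<open>i < j\<close>. (For \<open>n = 1\<close> the latter condition is void.)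
\<close>

definition kan_fibration :: "'a sset \<Rightarrow> 'b sset \<Rightarrow> (nat \<Rightarrow> 'a \<Rightarrow> 'b) \<Rightarrow> bool" where
  "kan_fibration E B p \<longleftrightarrow> simplicial_map E B p \<and>
     (\<forall>n k x y. 1 \<le> n \<and> k \<le> n \<and>
        (\<forall>i\<le>n. i \<noteq> k \<longrightarrow> x i \<in> cells E (n - 1)) \<and>
        (\<forall>i j. i < j \<and> j \<le> n \<and> i \<noteq> k \<and> j \<noteq> k \<longrightarrow>
           face E (n - 1) i (x j) = face E (n - 1) (j - 1) (x i)) \<and>
        y \<in> cells B n \<and>
        (\<forall>i\<le>n. i \<noteq> k \<longrightarrow> face B n i y = p (n - 1) (x i)) \<longrightarrow>
        (\<exists>e\<in>cells E n. (\<forall>i\<le>n. i \<noteq> k \<longrightarrow> face E n i e = x i) \<and> p n e = y))"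

text \<open>\<open>\<pi>\<^sub>0\<close>: vertices modulo the equivalence relation generated by the edges.\<close>

definition pi0_rel :: "'a sset \<Rightarrow> ('a \<times> 'a) set" where
  "pi0_rel A = {(a, b). a \<in> cells A 0 \<and> b \<in> cells A 0 \<and>
     (a, b) \<in> ({(face A 1 1 e, face A 1 0 e) |e. e \<in> cells A 1} \<union>
               {(face A 1 0 e, face A 1 1 e) |e. e \<in> cells A 1})\<^sup>*}"

definition pi0 :: "'a sset \<Rightarrow> 'a set set" where
  "pi0 A = cells A 0 // pi0_rel A"

definition pi0_class :: "'a sset \<Rightarrow> 'a \<Rightarrow> 'a set" where
  "pi0_class A a = pi0_rel A `` {a}"

text \<open>
  The simplicial homotopy groups \<open>\<pi>\<^sub>n(A, v)\<close>, \<open>n \<ge> 1\<close>, of a Kan complex \<open>A\<close>: the \<open>n\<close>-simplices all of whose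
  faces are constant at \<open>v\<close>, modulo Kan's homotopy relation. The latter is an equivalence relation
  because \<open>A\<close> is a Kan complex.
\<close>

definition sphere_cells :: "'a sset \<Rightarrow> nat \<Rightarrow> 'a \<Rightarrow> 'a set" where
  "sphere_cells A n v = {a \<in> cells A n. \<forall>i\<le>n. face A n i a = const_cell A (n - 1) v}"

definition pi_rel :: "'a sset \<Rightarrow> nat \<Rightarrow> 'a \<Rightarrow> ('a \<times> 'a) set" where
  "pi_rel A n v = {(a, b). a \<in> sphere_cells A n v \<and> b \<in> sphere_cells A n v \<and>
     (\<exists>z\<in>cells A (Suc n). face A (Suc n) n z = a \<and> face A (Suc n) (Suc n) z = b \<and>
        (\<forall>i<n. face A (Suc n) i z = const_cell A n v))}"

definition pi_set :: "'a sset \<Rightarrow> nat \<Rightarrow> 'a \<Rightarrow> 'a set set" where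
  "pi_set A n v = sphere_cells A n v // pi_rel A n v"

text \<open>
  Weak homotopy equivalences between Kan complexes: the induced maps on \<open>\<pi>\<^sub>0\<close> and on all homotopy groups
  at all base points are bijective. (The induced maps of homotopy groups are homomorphisms, so that
  bijectivity amounts to being an isomorphism.) The definition is only meant for Kan complexes \<open>A\<close>, \<open>B\<close>.
\<close>

definition weak_equivalence :: "'a sset \<Rightarrow> 'b sset \<Rightarrow> (nat \<Rightarrow> 'a \<Rightarrow> 'b) \<Rightarrow> bool" where
  "weak_equivalence A B f \<longleftrightarrow> simplicial_map A B f \<and>
     bij_betw (\<lambda>c. pi0_rel B `` (f 0 ` c)) (pi0 A) (pi0 B) \<and>
     (\<forall>n\<ge>1. \<forall>v\<in>cells A 0.
        bij_betw (\<lambda>c. pi_rel B n (f 0 v) `` (f n ` c)) (pi_set A n v) (pi_set B n (f 0 v)))"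

section \<open>Bisimplicial sets\<close>

text \<open>
  \<open>bact X k l n m \<alpha> \<theta> : X\<^bsub>nm\<^esub> \<rightarrow> X\<^bsub>kl\<^esub>\<close> is the action of \<open>\<alpha> : [k] \<rightarrow> [n]\<close> in the first (horizontal) and
  \<open>\<theta> : [l] \<rightarrow> [m]\<close> in the second (vertical) variable.
\<close>

record 'a bisset =
  bcells :: "nat \<Rightarrow> nat \<Rightarrow> 'a set"
  bact :: "nat \<Rightarrow> nat \<Rightarrow> nat \<Rightarrow> nat \<Rightarrow> (nat \<Rightarrow> nat) \<Rightarrow> (nat \<Rightarrow> nat) \<Rightarrow> 'a \<Rightarrow> 'a"

definition bisimplicial_set :: "'a bisset \<Rightarrow> bool" where
  "bisimplicial_set X \<longleftrightarrow>
     (\<forall>k l n m. \<forall>\<alpha>\<in>ord_maps k n. \<forall>\<theta>\<in>ord_maps l m. \<forall>x\<in>bcells X n m.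
        bact X k l n m \<alpha> \<theta> x \<in> bcells X k l) \<and>
     (\<forall>n m. \<forall>x\<in>bcells X n m. bact X n m n m (ord_id n) (ord_id m) x = x) \<and>
     (\<forall>p q k l n m. \<forall>\<beta>\<in>ord_maps p k. \<forall>\<phi>\<in>ord_maps q l. \<forall>\<alpha>\<in>ord_maps k n. \<forall>\<theta>\<in>ord_maps l m.
        \<forall>x\<in>bcells X n m.
        bact X p q n m (compose {..p} \<alpha> \<beta>) (compose {..q} \<theta> \<phi>) x =
        bact X p q k l \<beta> \<phi> (bact X k l n m \<alpha> \<theta> x))"

text \<open>\<open>Hom(Y, X)\<close>; the components are extensional functions, so that equal maps are equal in HOL.\<close>

definition bisimplicial_maps :: "'b bisset \<Rightarrow> 'a bisset \<Rightarrow> (nat \<Rightarrow> nat \<Rightarrow> 'b \<Rightarrow> 'a) set" where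
  "bisimplicial_maps Y X = {h.
     (\<forall>n m. h n m \<in> bcells Y n m \<rightarrow>\<^sub>E bcells X n m) \<and>
     (\<forall>k l n m. \<forall>\<alpha>\<in>ord_maps k n. \<forall>\<theta>\<in>ord_maps l m. \<forall>y\<in>bcells Y n m.
        h k l (bact Y k l n m \<alpha> \<theta> y) = bact X k l n m \<alpha> \<theta> (h n m y))}"

definition column :: "'a bisset \<Rightarrow> nat \<Rightarrow> 'a sset" where
  "column X n = \<lparr>cells = bcells X n, act = (\<lambda>l m \<theta>. bact X n l n m (ord_id n) \<theta>)\<rparr>"

lemma simplicial_set_column: assumes X: "bisimplicial_set X" shows "simplicial_set (column X n)"
  unfolding simplicial_set_def
proof (intro conjI allI ballI)
  fix k m l \<phi> \<theta> x assume h: "\<phi> \<in> ord_maps k m" "\<theta> \<in> ord_maps m l" "x \<in> cells (column X n) l"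
  then show "act (column X n) k l (compose {..k} \<theta> \<phi>) x = act (column X n) k m \<phi> (act (column X n) m l \<theta> x)"
    using X[unfolded bisimplicial_set_def, THEN conjunct2, THEN conjunct2, rule_format,
        of "ord_id n" n n \<phi> k m "ord_id n" n \<theta> l x] by (simp add: column_def ord_id_in ord_comp_id_right[OF ord_id_in])
qed (use X in \<open>simp_all add: column_def bisimplicial_set_def ord_id_in\<close>)

text \<open>
  \<open>hface X n i m\<close> is \<open>d\<^sub>i : X\<^bsub>n,m\<^esub> \<rightarrow> X\<^bsub>n-1,m\<^esub>\<close> (for \<open>n \<ge> 1\<close>), and \<open>hdegen X n i m\<close> is
  \<open>s\<^sub>i : X\<^bsub>n,m\<^esub> \<rightarrow> X\<^bsub>n+1,m\<^esub>\<close>.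
\<close>

definition hface :: "'a bisset \<Rightarrow> nat \<Rightarrow> nat \<Rightarrow> nat \<Rightarrow> 'a \<Rightarrow> 'a" where
  "hface X n i m = bact X (n - 1) m n m (coface n i) (ord_id m)"

definition hdegen :: "'a bisset \<Rightarrow> nat \<Rightarrow> nat \<Rightarrow> nat \<Rightarrow> 'a \<Rightarrow> 'a" where
  "hdegen X n i m = bact X (Suc n) m n m (codegen n i) (ord_id m)"

definition box :: "'a sset \<Rightarrow> 'b sset \<Rightarrow> ('a \<times> 'b) bisset" where
  "box A B = \<lparr>bcells = (\<lambda>n m. cells A n \<times> cells B m),
              bact = (\<lambda>k l n m \<alpha> \<theta> (a, b). (act A k n \<alpha> a, act B l m \<theta> b))\<rparr>"

text \<open>
  The simplicial set \<open>A \ X\<close> with \<open>(A \ X)\<^sub>m = Hom(A \<box> \<Delta>\<^sup>m, X)\<close>.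
\<close>

definition ldiv :: "'b sset \<Rightarrow> 'a bisset \<Rightarrow> (nat \<Rightarrow> nat \<Rightarrow> 'b \<times> (nat \<Rightarrow> nat) \<Rightarrow> 'a) sset" where
  "ldiv A X = \<lparr>cells = (\<lambda>m. bisimplicial_maps (box A (std_simplex m)) X),
     act = (\<lambda>l m \<theta> h p q. \<lambda>(a, \<phi>)\<in>bcells (box A (std_simplex l)) p q. h p q (a, compose {..q} \<theta> \<phi>))\<rparr>"

lemma simplicial_set_ldiv: assumes X: "bisimplicial_set X" and A: "simplicial_set A" shows "simplicial_set (ldiv A X)"
  unfolding simplicial_set_def
proof (intro conjI allI ballI)
  fix m n \<theta> a assume t: "\<theta> \<in> ord_maps m n" and a: "a \<in> cells (ldiv A X) n"
  show "act (ldiv A X) m n \<theta> a \<in> cells (ldiv A X) m"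
    using t a A
    by (auto simp: ldiv_def bisimplicial_maps_def box_def std_simplex_def PiE_iff Pi_iff ord_comp_in simplicial_set_def ord_comp_assoc)
next
  fix n a assume a: "a \<in> cells (ldiv A X) n"
  then show "act (ldiv A X) n n (ord_id n) a = a"
    by (auto simp: ldiv_def bisimplicial_maps_def box_def std_simplex_def PiE_iff Pi_iff fun_eq_iff extensional_def ord_comp_id_left)
next
  fix k m n \<phi> \<theta> a assume "\<phi> \<in> ord_maps k m" "\<theta> \<in> ord_maps m n" and a: "a \<in> cells (ldiv A X) n"
  then show "act (ldiv A X) k n (compose {..k} \<theta> \<phi>) a = act (ldiv A X) k m \<phi> (act (ldiv A X) m n \<theta> a)"
    by (auto simp: ldiv_def bisimplicial_maps_def box_def std_simplex_def fun_eq_iff ord_comp_assoc ord_comp_in)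
qed

text \<open>The restriction \<open>B \ X \<rightarrow> A \ X\<close> along the inclusion of a simplicial subset \<open>A \<subseteq> B\<close>.\<close>

definition ldiv_restrict ::
  "'b sset \<Rightarrow> nat \<Rightarrow> (nat \<Rightarrow> nat \<Rightarrow> 'b \<times> (nat \<Rightarrow> nat) \<Rightarrow> 'a) \<Rightarrow> nat \<Rightarrow> nat \<Rightarrow> 'b \<times> (nat \<Rightarrow> nat) \<Rightarrow> 'a" where
  "ldiv_restrict A m h = (\<lambda>p q. restrict (h p q) (bcells (box A (std_simplex m)) p q))"

text \<open>The Yoneda isomorphism \<open>X\<^sub>n \<cong> \<Delta>\<^sup>n \ X\<close>.\<close>

definition yoneda ::
  "'a bisset \<Rightarrow> nat \<Rightarrow> nat \<Rightarrow> 'a \<Rightarrow> nat \<Rightarrow> nat \<Rightarrow> (nat \<Rightarrow> nat) \<times> (nat \<Rightarrow> nat) \<Rightarrow> 'a" where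
  "yoneda X n m x =
     (\<lambda>p q. \<lambda>(\<alpha>, \<theta>)\<in>bcells (box (std_simplex n) (std_simplex m)) p q. bact X p q n m \<alpha> \<theta> x)"

lemma bij_betw_yoneda: assumes X: "bisimplicial_set X" shows "bij_betw (yoneda X n m) (cells (column X n) m) (cells (ldiv (std_simplex n) X) m)"
proof (rule bij_betwI[where g = "\<lambda>h. h n m (ord_id n, ord_id m)"])
  show "yoneda X n m \<in> cells (column X n) m \<rightarrow> cells (ldiv (std_simplex n) X) m"
    using X by (auto simp: yoneda_def column_def ldiv_def bisimplicial_maps_def box_def std_simplex_def bisimplicial_set_def ord_comp_in PiE_iff extensional_def split: if_splits)
  show "(\<lambda>h. h n m (ord_id n, ord_id m)) \<in> cells (ldiv (std_simplex n) X) m \<rightarrow> cells (column X n) m"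
    by (auto simp: column_def ldiv_def bisimplicial_maps_def box_def std_simplex_def ord_id_in PiE_iff)
  show "yoneda X n m x n m (ord_id n, ord_id m) = x" if "x \<in> cells (column X n) m" for x
    using that X by (auto simp: yoneda_def column_def box_def std_simplex_def bisimplicial_set_def ord_id_in)
  show "yoneda X n m (h n m (ord_id n, ord_id m)) = h" if h: "h \<in> cells (ldiv (std_simplex n) X) m" for h
  proof -
    have 1: "bact X p q n m \<alpha> \<theta> (h n m (ord_id n, ord_id m)) = h p q (\<alpha>,\<theta>)" if "\<alpha> \<in> ord_maps p n" "\<theta> \<in> ord_maps q m" for p q \<alpha> \<theta>
    proof -
      have "h p q (bact (box (std_simplex n) (std_simplex m)) p q n m \<alpha> \<theta> (ord_id n, ord_id m)) = bact X p q n m \<alpha> \<theta> (h n m (ord_id n, ord_id m))"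
        using h that by (simp add: ldiv_def bisimplicial_maps_def box_def std_simplex_def ord_id_in)
      then show ?thesis using that by (simp add: box_def std_simplex_def ord_comp_id_left)
    qed
    then show ?thesis using h
     by (auto simp: yoneda_def ldiv_def bisimplicial_maps_def box_def std_simplex_def fun_eq_iff PiE_iff extensional_def)
  qed
qed

lemma simplicial_map_yoneda: assumes X: "bisimplicial_set X" shows "simplicial_map (column X n) (ldiv (std_simplex n) X) (yoneda X n)"
  unfolding simplicial_map_def
proof (intro conjI allI ballI)
  show "yoneda X n k \<in> cells (column X n) k \<rightarrow> cells (ldiv (std_simplex n) X) k" for k
    using bij_betw_yoneda[OF X, of n k] by (auto simp: bij_betw_def)
  fix m k \<theta> a assume t: "\<theta> \<in> ord_maps m k" and a: "a \<in> cells (column X n) k"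
  have 1: "bact X p q n m \<alpha> \<phi> (bact X n m n k (ord_id n) \<theta> a) = bact X p q n k \<alpha> (compose {..q} \<theta> \<phi>) a"
    if "\<alpha> \<in> ord_maps p n" "\<phi> \<in> ord_maps q m" for p q \<alpha> \<phi>
    using X[unfolded bisimplicial_set_def, THEN conjunct2, THEN conjunct2, rule_format, of \<alpha> p n \<phi> q m "ord_id n" n \<theta> k a]
      that t a ord_id_in[of n] by (simp add: column_def ord_comp_id_left)
  show "yoneda X n m (act (column X n) m k \<theta> a) = act (ldiv (std_simplex n) X) m k \<theta> (yoneda X n k a)"
    using t 1 by (auto simp: yoneda_def column_def ldiv_def box_def std_simplex_def fun_eq_iff ord_comp_in)
qed

text \<open>
  The \<open>n\<close>-th matching object of the simplicial object \<open>n \<mapsto> X\<^sub>n\<close> is \<open>\<partial>\<Delta>\<^sup>n \ X\<close>; Reedy fibrancy means that all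
  matching maps \<open>X\<^sub>n \<rightarrow> \<partial>\<Delta>\<^sup>n \ X\<close> are Kan fibrations.
\<close>

definition matching_map ::
  "'a bisset \<Rightarrow> nat \<Rightarrow> nat \<Rightarrow> 'a \<Rightarrow> nat \<Rightarrow> nat \<Rightarrow> (nat \<Rightarrow> nat) \<times> (nat \<Rightarrow> nat) \<Rightarrow> 'a" where
  "matching_map X n m x = ldiv_restrict (simplex_boundary n) m (yoneda X n m x)"

definition v_fibrant :: "'a bisset \<Rightarrow> bool" where
  "v_fibrant X \<longleftrightarrow>
     (\<forall>n. kan_fibration (column X n) (ldiv (simplex_boundary n) X) (matching_map X n))"

section \<open>Bousfield-Segal spaces\<close>

definition bousfield_map ::
  "'a bisset \<Rightarrow> nat \<Rightarrow> nat \<Rightarrow> 'a \<Rightarrow> nat \<Rightarrow> nat \<Rightarrow> (nat \<Rightarrow> nat) \<times> (nat \<Rightarrow> nat) \<Rightarrow> 'a" where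
  "bousfield_map X n m x = ldiv_restrict (star_edges n) m (yoneda X n m x)"

text \<open>
  If \<open>X\<close> is v-fibrant, then \<open>A \ X\<close> is a Kan complex for every \<open>A\<close>, so that \<^const>\<open>weak_equivalence\<close> is
  applied to Kan complexes here.
\<close>

definition bousfield_segal_space :: "'a bisset \<Rightarrow> bool" where
  "bousfield_segal_space X \<longleftrightarrow> bisimplicial_set X \<and> v_fibrant X \<and>
     (\<forall>n\<ge>2. weak_equivalence (column X n) (ldiv (star_edges n) X) (bousfield_map X n))"

text \<open>The fibre product of \<open>X\<^sub>1\<close> with itself over \<open>X\<^sub>0\<close>, along \<open>d\<^sub>1\<close> on both sides.\<close>

definition bousfield_pairs :: "'a bisset \<Rightarrow> ('a \<times> 'a) sset" where
  "bousfield_pairs X = \<lparr>cells = (\<lambda>m. {(f, g). f \<in> bcells X 1 m \<and> g \<in> bcells X 1 m \<and>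
                                        hface X 1 1 m f = hface X 1 1 m g}),
     act = (\<lambda>l m \<theta> (f, g). (act (column X 1) l m \<theta> f, act (column X 1) l m \<theta> g))\<rparr>"

text \<open>
  Sections of \<open>\<beta>\<^sub>2\<close>, which is \<open>\<sigma> \<mapsto> (d\<^sub>1 \<sigma>, d\<^sub>2 \<sigma>)\<close> under the identification of \<open>C\<^sub>2 \ X\<close> with the fibre product
  above.
\<close>

definition bousfield_section :: "'a bisset \<Rightarrow> (nat \<Rightarrow> 'a \<times> 'a \<Rightarrow> 'a) \<Rightarrow> bool" where
  "bousfield_section X mu \<longleftrightarrow> simplicial_map (bousfield_pairs X) (column X 2) mu \<and>
     (\<forall>m. \<forall>(f, g)\<in>cells (bousfield_pairs X) m.
        hface X 2 1 m (mu m (f, g)) = f \<and> hface X 2 2 m (mu m (f, g)) = g)"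

text \<open>The fibre \<open>X\<^sub>1(x, y)\<close> of \<open>(d\<^sub>1, d\<^sub>0) : X\<^sub>1 \<rightarrow> X\<^sub>0 \<times> X\<^sub>0\<close> over \<open>(x, y)\<close>.\<close>

definition map_space :: "'a bisset \<Rightarrow> 'a \<Rightarrow> 'a \<Rightarrow> 'a sset" where
  "map_space X x y = (column X 1)\<lparr>cells := (\<lambda>m. {f \<in> bcells X 1 m.
     hface X 1 1 m f = const_cell (column X 0) m x \<and>
     hface X 1 0 m f = const_cell (column X 0) m y})\<rparr>"

definition unit_vertex :: "'a bisset \<Rightarrow> 'a \<Rightarrow> 'a" where
  "unit_vertex X x = hdegen X 0 0 0 x"

text \<open>The fraction \<open>f / g\<close> on vertices of \<open>X\<^sub>1\<close>.\<close>

definition frac :: "'a bisset \<Rightarrow> (nat \<Rightarrow> 'a \<times> 'a \<Rightarrow> 'a) \<Rightarrow> 'a \<Rightarrow> 'a \<Rightarrow> 'a" where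
  "frac X mu f g = hface X 2 0 0 (mu 0 (f, g))"

lemma frac_in_map_space:
  assumes X: "bisimplicial_set X" and mu: "bousfield_section X mu"
    and f: "f \<in> cells (map_space X x y) 0" and g: "g \<in> cells (map_space X x z) 0"
  shows "frac X mu f g \<in> cells (map_space X z y) 0"
proof -
  let ?s = "mu 0 (f,g)"
  have fg: "(f,g) \<in> cells (bousfield_pairs X) 0" using f g by (auto simp: bousfield_pairs_def map_space_def)
  then have s: "?s \<in> bcells X 2 0" "hface X 2 1 0 ?s = f" "hface X 2 2 0 ?s = g"
    using mu by (auto simp: bousfield_section_def simplicial_map_def column_def)
  have cc: "hface X 1 i 0 (hface X 2 j 0 ?s) = bact X 0 0 2 0 (compose {..0} (coface 2 j) (coface 1 i)) (ord_id 0) ?s" if "i \<le> 1" "j \<le> 2" for i j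
  proof -
    have "bact X 0 0 2 0 (compose {..0} (coface 2 j) (coface 1 i)) (compose {..0} (ord_id 0) (ord_id 0)) ?s = bact X 0 0 1 0 (coface 1 i) (ord_id 0) (bact X 1 0 2 0 (coface 2 j) (ord_id 0) ?s)"
      using X[unfolded bisimplicial_set_def, THEN conjunct2, THEN conjunct2, rule_format, of "coface 1 i" 0 1 "ord_id 0" 0 0 "coface 2 j" 2 "ord_id 0" 0 ?s] that s(1) coface_in[of 1 i] coface_in[of 2 j] ord_id_in[of 0] by simp
    moreover have "compose {..0} (ord_id 0) (ord_id 0) = ord_id 0" by (rule ord_comp_id_right[OF ord_id_in])
    ultimately show ?thesis by (simp add: hface_def numeral_2_eq_2)
  qed
  have e1: "compose {..0} (coface 2 0) (coface 1 1) = compose {..0} (coface 2 2) (coface 1 0)"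
   and e0: "compose {..0} (coface 2 0) (coface 1 0) = compose {..0} (coface 2 1) (coface 1 0)"
    by (auto simp: compose_def coface_def fun_eq_iff)
  have "hface X 1 1 0 (frac X mu f g) = hface X 1 0 0 g" "hface X 1 0 0 (frac X mu f g) = hface X 1 0 0 f"
    using cc[of 1 0] cc[of 0 2] cc[of 0 0] cc[of 0 1] e1 e0 s by (auto simp: frac_def)
  moreover have "frac X mu f g \<in> bcells X 1 0"
    using X s(1) coface_in[of 2 0] ord_id_in[of 0] by (auto simp: frac_def hface_def bisimplicial_set_def)
  ultimately show ?thesis using f g by (simp add: map_space_def)
qed

definition Ho_B :: "'a bisset \<Rightarrow> 'a \<Rightarrow> 'a \<Rightarrow> 'a set set" where
  "Ho_B X x y = pi0 (map_space X x y)"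

text \<open>
  The map \<open>Ho_B X x y \<times> Ho_B X x z \<rightarrow> Ho_B X z y\<close>, \<open>([f], [g]) \<mapsto> [f / g]\<close>: the set to which \<^const>\<open>the_elem\<close>
  is applied consists of the classes \<open>[f / g]\<close> for all representatives, and it is a singleton because
  the fraction operation descends to \<open>\<pi>\<^sub>0\<close>.
\<close>

definition Ho_frac ::
  "'a bisset \<Rightarrow> (nat \<Rightarrow> 'a \<times> 'a \<Rightarrow> 'a) \<Rightarrow> 'a \<Rightarrow> 'a \<Rightarrow> 'a \<Rightarrow> 'a set \<Rightarrow> 'a set \<Rightarrow> 'a set" where
  "Ho_frac X mu x y z F G =
     the_elem {pi0_class (map_space X z y) (frac X mu f g) |f g. f \<in> F \<and> g \<in> G}"

text \<open>\<open>Ho_comp X mu x y z : Ho_B X y z \<times> Ho_B X x y \<rightarrow> Ho_B X x z\<close>, \<open>(G, F) \<mapsto> G / ([1\<^sub>x] / F)\<close>.\<close>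

definition Ho_comp ::
  "'a bisset \<Rightarrow> (nat \<Rightarrow> 'a \<times> 'a \<Rightarrow> 'a) \<Rightarrow> 'a \<Rightarrow> 'a \<Rightarrow> 'a \<Rightarrow> 'a set \<Rightarrow> 'a set \<Rightarrow> 'a set" where
  "Ho_comp X mu x y z G F =
     Ho_frac X mu y z x G
       (Ho_frac X mu x x y (pi0_class (map_space X x x) (unit_vertex X x)) F)"

section \<open>Groupoids\<close>

text \<open>
  A groupoid with set of objects \<open>Ob\<close>, hom-sets \<open>Hom x y\<close> (a family of sets, not required to be disjoint)
  and composition \<open>cmp x y z : Hom y z \<times> Hom x y \<rightarrow> Hom x z\<close>.
\<close>

definition groupoid ::
  "'o set \<Rightarrow> ('o \<Rightarrow> 'o \<Rightarrow> 'h set) \<Rightarrow> ('o \<Rightarrow> 'o \<Rightarrow> 'o \<Rightarrow> 'h \<Rightarrow> 'h \<Rightarrow> 'h) \<Rightarrow> bool" where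
  "groupoid Ob Hom cmp \<longleftrightarrow>
     (\<forall>x\<in>Ob. \<forall>y\<in>Ob. \<forall>z\<in>Ob. \<forall>g\<in>Hom y z. \<forall>f\<in>Hom x y. cmp x y z g f \<in> Hom x z) \<and>
     (\<forall>w\<in>Ob. \<forall>x\<in>Ob. \<forall>y\<in>Ob. \<forall>z\<in>Ob. \<forall>h\<in>Hom y z. \<forall>g\<in>Hom x y. \<forall>f\<in>Hom w x.
        cmp w y z h (cmp w x y g f) = cmp w x z (cmp x y z h g) f) \<and>
     (\<exists>ident.
        (\<forall>x\<in>Ob. ident x \<in> Hom x x) \<and>
        (\<forall>x\<in>Ob. \<forall>y\<in>Ob. \<forall>f\<in>Hom x y.
           cmp x y y (ident y) f = f \<and> cmp x x y f (ident x) = f \<and>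
           (\<exists>g\<in>Hom y x. cmp x y x g f = ident x \<and> cmp y x y f g = ident y)))"

end

theory Submission
  imports Defs
begin

text \<open>
  A groupoid can be axiomatised by its fractions \<open>f / g = f \<circ> g\<^sup>-\<^sup>1\<close> instead of its composition: the
  laws \<open>f / 1 = f\<close>, \<open>f / f = 1\<close> and \<open>(f / h) / (g / h) = f / g\<close> suffice, and the composite is recovered as
  \<open>g / (1 / f)\<close> (\<open>groupoid_of_fractions\<close>). So everything comes down to these three laws up to homotopy,
  together with invariance of the fraction under homotopy.

  Two vertices of \<open>X\<^sub>1(x, y)\<close> lie in one path component iff an edge of \<open>X\<^sub>1\<close> over the degenerate edges at
  \<open>x\<close> and \<open>y\<close> joins them, because \<open>X\<^sub>1 \<rightarrow> X\<^sub>0 \<times> X\<^sub>0\<close> is a Kan fibration (it is the matching map for \<open>n = 1\<close>).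
  Since the section \<open>mu\<close> is simplicial, it divides such edges as well as vertices, which gives
  invariance (\<open>fraction_cong\<close>). All three laws follow from one uniqueness statement
  (\<open>fraction_unique\<close>): every \<open>\<sigma>\<close> in \<open>X\<^sub>2\<close> computes the fraction of its faces, that is
  \<open>d\<^sub>0 \<sigma> \<simeq> d\<^sub>1 \<sigma> / d\<^sub>2 \<sigma>\<close>. The degenerate simplices \<open>s\<^sub>0 f\<close> and \<open>s\<^sub>1 f\<close> give the first two laws, and the four
  faces of a simplex in \<open>X\<^sub>3\<close> with edges \<open>h\<close>, \<open>g\<close>, \<open>f\<close> out of its vertex \<open>0\<close> give the third.

  Both the uniqueness and the passage from the star of a simplex in \<open>X\<^sub>3\<close> to an arbitrary triple
  \<open>(h, g, f)\<close> rest on a transport principle (\<open>fibre_path_transport\<close>): if two edges of the total space of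
  a Kan fibration have the same image, then their starting points are joined by a path in the fibre
  iff their end points are. Consequently a law \<open>E(\<xi>) \<simeq> E'(\<xi>)\<close> between two simplicial expressions with
  values in \<open>X\<^sub>1\<close>, whose sources and targets agree, holds at both or at neither of two points \<open>\<xi>\<close> that a
  zigzag of edges connects. As the Bousfield map \<open>\<beta>\<^sub>2\<close> is injective on \<open>\<pi>\<^sub>0\<close>, the simplices \<open>\<sigma>\<close> and
  \<open>mu (\<beta>\<^sub>2 \<sigma>)\<close> are connected, and for the latter the uniqueness statement is trivial. As \<open>\<beta>\<^sub>3\<close> is
  surjective on \<open>\<pi>\<^sub>0\<close>, every triple \<open>(h, g, f)\<close> is connected to the star of a simplex in \<open>X\<^sub>3\<close>.
\<close>

text \<open>
  Dimensions are written as numerals throughout, so \<open>1\<close> rather than \<open>Suc 0\<close> is the simplifier's normal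
  form.
\<close>

declare One_nat_def [simp del] One_nat_def [symmetric, simp]

section \<open>Groupoids from fractions\<close>

text \<open>
  Write \<open>g\<^sup>-\<^sup>1 = 1 / g\<close>. Substituting \<open>f / f = 1\<close> into the law for \<open>(f / h) / (g / h)\<close> gives
  \<open>(f / g)\<^sup>-\<^sup>1 = g / f\<close>, hence \<open>(f\<^sup>-\<^sup>1)\<^sup>-\<^sup>1 = f\<close>. Associativity is the identity
  \<open>(h / g\<^sup>-\<^sup>1) / k = h / (k / g)\<close> for \<open>k = f\<^sup>-\<^sup>1\<close>; it is the third law again, because \<open>k = (k / g) / g\<^sup>-\<^sup>1\<close>.
\<close>

lemma groupoid_of_fractions:
  assumes unit: "\<And>x. x \<in> Ob \<Longrightarrow> u x \<in> Hom x x"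
    and dv: "\<And>x y z f g. \<lbrakk>x \<in> Ob; y \<in> Ob; z \<in> Ob; f \<in> Hom x y; g \<in> Hom x z\<rbrakk> \<Longrightarrow> dv x y z f g \<in> Hom z y"
    and dv_unit: "\<And>x y f. \<lbrakk>x \<in> Ob; y \<in> Ob; f \<in> Hom x y\<rbrakk> \<Longrightarrow> dv x y x f (u x) = f"
    and dv_self: "\<And>x y f. \<lbrakk>x \<in> Ob; y \<in> Ob; f \<in> Hom x y\<rbrakk> \<Longrightarrow> dv x y y f f = u y"
    and dv_dv: "\<And>w x y z f g h. \<lbrakk>w \<in> Ob; x \<in> Ob; y \<in> Ob; z \<in> Ob; f \<in> Hom w x; g \<in> Hom w y; h \<in> Hom w z\<rbrakk>
      \<Longrightarrow> dv z x y (dv w x z f h) (dv w y z g h) = dv w x y f g"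
  shows "groupoid Ob Hom (\<lambda>x y z g f. dv y z x g (dv x x y (u x) f))"
proof -
  let ?inv = "\<lambda>x y f. dv x x y (u x) f"
  have inv: "?inv x y f \<in> Hom y x" if "x \<in> Ob" "y \<in> Ob" "f \<in> Hom x y" for x y f
    using that by (simp add: dv unit)
  have inv_dv: "?inv z y (dv x y z f g) = dv x z y g f"
    if "x \<in> Ob" "y \<in> Ob" "z \<in> Ob" "f \<in> Hom x y" "g \<in> Hom x z" for x y z f g
    using dv_dv[of x z y z g f g] that by (simp add: dv_self)
  have inv_inv: "?inv y x (?inv x y f) = f" if "x \<in> Ob" "y \<in> Ob" "f \<in> Hom x y" for x y f
    using that by (simp add: inv_dv unit dv_unit)
  have assoc: "dv x z w (dv y z x h (?inv x y g)) k = dv y z w h (dv x w y k g)"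
    if "w \<in> Ob" "x \<in> Ob" "y \<in> Ob" "z \<in> Ob" "h \<in> Hom y z" "g \<in> Hom x y" "k \<in> Hom x w" for w x y z h g k
  proof -
    have "dv y w x (dv x w y k g) (?inv x y g) = k"
      using dv_dv[of x w x y k "u x" g] that by (simp add: unit dv_unit)
    then show ?thesis
      using dv_dv[of y z w x h "dv x w y k g" "?inv x y g"] that by (simp add: dv inv)
  qed
  show ?thesis
    unfolding groupoid_def
  proof (intro conjI ballI exI[of _ u])
    fix w x y z h g f
    assume *: "w \<in> Ob" "x \<in> Ob" "y \<in> Ob" "z \<in> Ob" "h \<in> Hom y z" "g \<in> Hom x y" "f \<in> Hom w x"
    show "dv y z w h (?inv w y (dv x y w g (?inv w x f))) = dv x z w (dv y z x h (?inv x y g)) (?inv w x f)"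
      using * by (simp add: assoc inv inv_dv)
  next
    fix x y f assume *: "x \<in> Ob" "y \<in> Ob" "f \<in> Hom x y"
    show "\<exists>g\<in>Hom y x. dv y x x g (?inv x y f) = u x \<and> dv x y y f (?inv y x g) = u y"
      using * by (intro bexI[of _ "?inv x y f"]) (simp_all add: dv_self inv inv_inv)
  qed (simp_all add: unit dv inv inv_inv dv_unit dv_self)
qed

section \<open>Paths in the fibres of a Kan fibration\<close>

lemma act_in:
  "\<lbrakk>simplicial_set A; \<theta> \<in> ord_maps m n; a \<in> cells A n\<rbrakk> \<Longrightarrow> act A m n \<theta> a \<in> cells A m"
  by (simp add: simplicial_set_def)

lemma act_id: "\<lbrakk>simplicial_set A; a \<in> cells A n\<rbrakk> \<Longrightarrow> act A n n (ord_id n) a = a"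
  by (simp add: simplicial_set_def)

lemma act_act:
  "\<lbrakk>simplicial_set A; \<phi> \<in> ord_maps k m; \<theta> \<in> ord_maps m n; a \<in> cells A n\<rbrakk>
   \<Longrightarrow> act A k m \<phi> (act A m n \<theta> a) = act A k n (compose {..k} \<theta> \<phi>) a"
  by (simp add: simplicial_set_def)

lemma face_in: "\<lbrakk>simplicial_set A; 1 \<le> n; i \<le> n; a \<in> cells A n\<rbrakk> \<Longrightarrow> face A n i a \<in> cells A (n - 1)"
  by (simp add: face_def act_in coface_in)

lemma face_1_in: "\<lbrakk>simplicial_set A; i \<le> 1; a \<in> cells A 1\<rbrakk> \<Longrightarrow> face A 1 i a \<in> cells A 0"
  using face_in[of A 1 i a] by simp

lemma const_in: "(\<lambda>j\<in>{..m}. 0) \<in> ord_maps m 0"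
  by (auto simp: ord_maps_def mono_on_def)

lemma const_cell_in: "\<lbrakk>simplicial_set A; a \<in> cells A 0\<rbrakk> \<Longrightarrow> const_cell A m a \<in> cells A m"
  by (simp add: const_cell_def act_in const_in)

lemma const_cell_0: "\<lbrakk>simplicial_set A; a \<in> cells A 0\<rbrakk> \<Longrightarrow> const_cell A 0 a = a"
proof -
  have "(\<lambda>j\<in>{..0::nat}. 0::nat) = ord_id 0" by (auto simp: ord_id_def)
  then show "\<lbrakk>simplicial_set A; a \<in> cells A 0\<rbrakk> \<Longrightarrow> const_cell A 0 a = a"
    by (simp add: const_cell_def act_id)
qed

lemma face_const_cell:
  assumes A: "simplicial_set A" "a \<in> cells A 0" and i: "i \<le> 1"
  shows "face A 1 i (const_cell A 1 a) = a"
proof -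
  have "compose {..0} (\<lambda>j\<in>{..1}. 0) (coface 1 i) = ord_id 0"
    by (auto simp: compose_def coface_def ord_id_def fun_eq_iff)
  then show ?thesis
    using A i coface_in[of 1 i] by (simp add: face_def const_cell_def act_act[OF _ _ const_in] act_id)
qed

lemma simplicial_map_in: "\<lbrakk>simplicial_map A B f; a \<in> cells A n\<rbrakk> \<Longrightarrow> f n a \<in> cells B n"
  by (auto simp: simplicial_map_def)

lemma simplicial_map_act:
  "\<lbrakk>simplicial_map A B f; \<theta> \<in> ord_maps m n; a \<in> cells A n\<rbrakk> \<Longrightarrow> f m (act A m n \<theta> a) = act B m n \<theta> (f n a)"
  by (simp add: simplicial_map_def)

lemma simplicial_map_face:
  "\<lbrakk>simplicial_map A B f; 1 \<le> n; i \<le> n; a \<in> cells A n\<rbrakk> \<Longrightarrow> f (n - 1) (face A n i a) = face B n i (f n a)"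
  by (simp add: face_def simplicial_map_act coface_in)

text \<open>
  The lifting problems below all have a base that is the image of a simplex \<open>e0\<close> of the total space,
  so that all simplicial identities are computed in the total space.
\<close>

lemma kan_refill:
  assumes E: "simplicial_set E" and p: "kan_fibration E B p" and e0: "e0 \<in> cells E n"
    and n: "1 \<le> n" "k \<le> n"
    and x: "\<And>i. \<lbrakk>i \<le> n; i \<noteq> k\<rbrakk> \<Longrightarrow> x i \<in> cells E (n - 1)"
    and match: "\<And>i j. \<lbrakk>i < j; j \<le> n; i \<noteq> k; j \<noteq> k\<rbrakk> \<Longrightarrow> face E (n - 1) i (x j) = face E (n - 1) (j - 1) (x i)"
    and px: "\<And>i. \<lbrakk>i \<le> n; i \<noteq> k\<rbrakk> \<Longrightarrow> p (n - 1) (x i) = p (n - 1) (face E n i e0)"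
  obtains e where "e \<in> cells E n" "\<And>i. \<lbrakk>i \<le> n; i \<noteq> k\<rbrakk> \<Longrightarrow> face E n i e = x i"
    "p (n - 1) (face E n k e) = p (n - 1) (face E n k e0)"
proof -
  have sm: "simplicial_map E B p" using p by (simp add: kan_fibration_def)
  have "\<exists>e\<in>cells E n. (\<forall>i\<le>n. i \<noteq> k \<longrightarrow> face E n i e = x i) \<and> p n e = p n e0"
    using p[unfolded kan_fibration_def, THEN conjunct2, rule_format, of n k x "p n e0"]
      n x match px e0 by (simp add: simplicial_map_face[OF sm] simplicial_map_in[OF sm])
  then obtain e where e: "e \<in> cells E n" "\<forall>i\<le>n. i \<noteq> k \<longrightarrow> face E n i e = x i" "p n e = p n e0"
    by blast
  moreover have "p (n - 1) (face E n k e) = p (n - 1) (face E n k e0)"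
    using e e0 n by (simp add: simplicial_map_face[OF sm])
  ultimately show thesis using that by blast
qed

lemma face_face_2:
  assumes A: "simplicial_set A" "a \<in> cells A 2" and ij: "i < j" "j \<le> 2"
  shows "face A 1 i (face A 2 j a) = face A 1 (j - 1) (face A 2 i a)"
proof -
  have "compose {..0} (coface 2 j) (coface 1 i) = compose {..0} (coface 2 i) (coface 1 (j - 1))"
    using ij by (auto simp: compose_def coface_def fun_eq_iff)
  then show ?thesis
    using A ij coface_in[of 1 i] coface_in[of 1 "j - 1"] coface_in[of 2 i] coface_in[of 2 j]
    by (simp add: face_def act_act)
qed

lemma face_degen:
  assumes A: "simplicial_set A" "u \<in> cells A 1"
  shows "\<And>i. i \<le> 1 \<Longrightarrow> act A 2 1 (codegen 1 i) u \<in> cells A 2"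
    and "face A 2 0 (act A 2 1 (codegen 1 0) u) = u"
    and "face A 2 1 (act A 2 1 (codegen 1 0) u) = u"
    and "face A 2 2 (act A 2 1 (codegen 1 0) u) = const_cell A 1 (face A 1 1 u)"
    and "face A 2 0 (act A 2 1 (codegen 1 1) u) = const_cell A 1 (face A 1 0 u)"
    and "face A 2 1 (act A 2 1 (codegen 1 1) u) = u"
    and "face A 2 2 (act A 2 1 (codegen 1 1) u) = u"
proof -
  have c: "codegen 1 i \<in> ord_maps 2 1" if "i \<le> 1" for i
    using codegen_in[OF that] by simp
  show "act A 2 1 (codegen 1 i) u \<in> cells A 2" if "i \<le> 1" for i
    using A c that by (simp add: act_in)
  have f: "face A 2 j (act A 2 1 (codegen 1 i) u) = act A 1 1 (compose {..1} (codegen 1 i) (coface 2 j)) u"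
    if "i \<le> 1" "j \<le> 2" for i j
    using A c[OF that(1)] coface_in[of 2 j] that by (simp add: face_def act_act)
  have k: "const_cell A 1 (face A 1 j u) = act A 1 1 (compose {..1} (coface 1 j) (\<lambda>i\<in>{..1}. 0)) u"
    if "j \<le> 1" for j
    using A coface_in[of 1 j] that const_in[of 1] by (simp add: face_def const_cell_def act_act)
  have e: "compose {..1} (codegen 1 0) (coface 2 0) = ord_id 1"
    "compose {..1} (codegen 1 0) (coface 2 1) = ord_id 1"
    "compose {..1} (codegen 1 0) (coface 2 2) = compose {..1} (coface 1 1) (\<lambda>i\<in>{..1}. 0)"
    "compose {..1} (codegen 1 1) (coface 2 0) = compose {..1} (coface 1 0) (\<lambda>i\<in>{..1}. 0)"
    "compose {..1} (codegen 1 1) (coface 2 1) = ord_id 1"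
    "compose {..1} (codegen 1 1) (coface 2 2) = ord_id 1"
    by (auto simp: compose_def coface_def codegen_def ord_id_def fun_eq_iff)
  show "face A 2 0 (act A 2 1 (codegen 1 0) u) = u"
    "face A 2 1 (act A 2 1 (codegen 1 0) u) = u"
    "face A 2 2 (act A 2 1 (codegen 1 0) u) = const_cell A 1 (face A 1 1 u)"
    "face A 2 0 (act A 2 1 (codegen 1 1) u) = const_cell A 1 (face A 1 0 u)"
    "face A 2 1 (act A 2 1 (codegen 1 1) u) = u"
    "face A 2 2 (act A 2 1 (codegen 1 1) u) = u"
    using A by (simp_all only: f k e act_id le_refl zero_le one_le_numeral)
qed

text \<open>
  An edge in the fibre of \<open>p\<close>: its image is the degenerate edge at \<open>p a\<close>, expressed as the image of a
  degenerate edge of the total space.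
\<close>

definition fibre_path :: "'a sset \<Rightarrow> (nat \<Rightarrow> 'a \<Rightarrow> 'b) \<Rightarrow> 'a \<Rightarrow> 'a \<Rightarrow> bool" where
  "fibre_path E p a b \<longleftrightarrow>
     (\<exists>e\<in>cells E 1. face E 1 1 e = a \<and> face E 1 0 e = b \<and> p 1 e = p 1 (const_cell E 1 a))"

lemma fibre_path_refl: "\<lbrakk>simplicial_set E; a \<in> cells E 0\<rbrakk> \<Longrightarrow> fibre_path E p a a"
  unfolding fibre_path_def
  by (rule bexI[of _ "const_cell E 1 a"]) (simp_all add: face_const_cell const_cell_in)

locale kan_fib =
  fixes E :: "'a sset" and B :: "'b sset" and p
  assumes E: "simplicial_set E" and p: "kan_fibration E B p"
begin

lemma refill:
  assumes e0: "e0 \<in> cells E 2" and ijk: "{i, j, k} = {..2}" "i < j" "k \<noteq> i" "k \<noteq> j"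
    and ab: "a \<in> cells E 1" "b \<in> cells E 1" "face E 1 i b = face E 1 (j - 1) a"
    and pab: "p 1 a = p 1 (face E 2 i e0)" "p 1 b = p 1 (face E 2 j e0)"
  obtains e where "e \<in> cells E 2" "face E 2 i e = a" "face E 2 j e = b"
    "p 1 (face E 2 k e) = p 1 (face E 2 k e0)"
proof -
  have le: "i \<le> 2" "j \<le> 2" "k \<le> 2" using ijk(1) by (metis atMost_iff insertI1 insert_commute)+
  have cases: "l = i \<or> l = j" if "l \<le> 2" "l \<noteq> k" for l
    using ijk(1) that by (metis atMost_iff insertE singletonD)
  have match: "face E (2 - 1) m (if l = i then a else b) = face E (2 - 1) (l - 1) (if m = i then a else b)"
    if "m < l" "l \<le> 2" "m \<noteq> k" "l \<noteq> k" for m l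
    using cases[of m] cases[of l] that ijk ab by auto
  have px: "p (2 - 1) (if l = i then a else b) = p (2 - 1) (face E 2 l e0)" if "l \<le> 2" "l \<noteq> k" for l
    using cases[OF that] pab by auto
  show thesis
  proof (rule kan_refill[OF E p e0, of k "\<lambda>l. if l = i then a else b"])
    fix e assume e: "e \<in> cells E 2" "\<And>l. \<lbrakk>l \<le> 2; l \<noteq> k\<rbrakk> \<Longrightarrow> face E 2 l e = (if l = i then a else b)"
      "p (2 - 1) (face E 2 k e) = p (2 - 1) (face E 2 k e0)"
    show thesis using e(1,3) e(2)[of i] e(2)[of j] ijk le by (intro that[of e]) auto
  qed (use ab px match le in auto)
qed

lemma faces_of_2_simplex: "{Suc 0, 2, 0} = {..2}" "{0, 2, Suc 0} = {..2}" "{0, Suc 0, 2} = {..2::nat}"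
  by auto

text \<open>
  Here and in the next two lemmas one of the three horns of a triangle is filled, and only the new edge
  is recorded. With \<open>e0\<close> a degenerate triangle on an edge \<open>u\<close>, this composes or cancels edges relative to the base.
\<close>

lemma refill_0:
  assumes "e0 \<in> cells E 2" "u \<in> cells E 1" "v \<in> cells E 1" "face E 1 1 u = face E 1 1 v"
    "p 1 u = p 1 (face E 2 2 e0)" "p 1 v = p 1 (face E 2 1 e0)"
  shows "\<exists>w\<in>cells E 1. face E 1 1 w = face E 1 0 u \<and> face E 1 0 w = face E 1 0 v \<and>
    p 1 w = p 1 (face E 2 0 e0)"
proof -
  obtain e where e: "e \<in> cells E 2" "face E 2 1 e = v" "face E 2 2 e = u"
    "p 1 (face E 2 0 e) = p 1 (face E 2 0 e0)"
    using refill[of e0 1 2 0 v u] assms faces_of_2_simplex by auto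
  show ?thesis
    using e face_face_2[OF E e(1), of 0 1] face_face_2[OF E e(1), of 0 2] face_in[OF E, of 2 0 e]
    by (intro bexI[of _ "face E 2 0 e"]) simp_all
qed

lemma refill_1:
  assumes "e0 \<in> cells E 2" "u \<in> cells E 1" "v \<in> cells E 1" "face E 1 0 u = face E 1 1 v"
    "p 1 u = p 1 (face E 2 2 e0)" "p 1 v = p 1 (face E 2 0 e0)"
  shows "\<exists>w\<in>cells E 1. face E 1 1 w = face E 1 1 u \<and> face E 1 0 w = face E 1 0 v \<and>
    p 1 w = p 1 (face E 2 1 e0)"
proof -
  obtain e where e: "e \<in> cells E 2" "face E 2 0 e = v" "face E 2 2 e = u"
    "p 1 (face E 2 1 e) = p 1 (face E 2 1 e0)"
    using refill[of e0 0 2 1 v u] assms faces_of_2_simplex by auto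
  show ?thesis
    using e face_face_2[OF E e(1), of 0 1] face_face_2[OF E e(1), of 1 2] face_in[OF E, of 2 1 e]
    by (intro bexI[of _ "face E 2 1 e"]) simp_all
qed

lemma refill_2:
  assumes "e0 \<in> cells E 2" "u \<in> cells E 1" "v \<in> cells E 1" "face E 1 0 u = face E 1 0 v"
    "p 1 u = p 1 (face E 2 1 e0)" "p 1 v = p 1 (face E 2 0 e0)"
  shows "\<exists>w\<in>cells E 1. face E 1 1 w = face E 1 1 u \<and> face E 1 0 w = face E 1 1 v \<and>
    p 1 w = p 1 (face E 2 2 e0)"
proof -
  obtain e where e: "e \<in> cells E 2" "face E 2 0 e = v" "face E 2 1 e = u"
    "p 1 (face E 2 2 e) = p 1 (face E 2 2 e0)"
    using refill[of e0 0 1 2 v u] assms faces_of_2_simplex by auto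
  show ?thesis
    using e face_face_2[OF E e(1), of 0 2] face_face_2[OF E e(1), of 1 2] face_in[OF E, of 2 2 e]
    by (intro bexI[of _ "face E 2 2 e"]) simp_all
qed

text \<open>
  The edges \<open>u\<close> and \<open>v\<close> out of a common vertex form a horn over the image of \<open>s\<^sub>1 u\<close>, whose remaining
  face is degenerate.
\<close>

lemma ends_connected:
  assumes uv: "u \<in> cells E 1" "v \<in> cells E 1" "p 1 u = p 1 v" "face E 1 1 u = face E 1 1 v"
  shows "fibre_path E p (face E 1 0 u) (face E 1 0 v)"
proof -
  obtain w where "w \<in> cells E 1" "face E 1 1 w = face E 1 0 u" "face E 1 0 w = face E 1 0 v"
    "p 1 w = p 1 (const_cell E 1 (face E 1 0 u))"
    using refill_0[OF face_degen(1)[OF E uv(1) le_refl] uv(1,2,4), unfolded face_degen(2-)[OF E uv(1)],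
        OF refl uv(3)[symmetric]] by blast
  then show ?thesis by (auto simp: fibre_path_def)
qed

lemma starts_connected:
  assumes uv: "u \<in> cells E 1" "v \<in> cells E 1" "p 1 u = p 1 v" "face E 1 0 u = face E 1 0 v"
  shows "fibre_path E p (face E 1 1 u) (face E 1 1 v)"
proof -
  obtain w where "w \<in> cells E 1" "face E 1 1 w = face E 1 1 u" "face E 1 0 w = face E 1 1 v"
    "p 1 w = p 1 (const_cell E 1 (face E 1 1 u))"
    using refill_2[OF face_degen(1)[OF E uv(1) zero_le] uv(1,2,4), unfolded face_degen(2-)[OF E uv(1)],
        OF refl uv(3)[symmetric]] by blast
  then show ?thesis by (auto simp: fibre_path_def)
qed

lemma fibre_path_in:
  assumes "fibre_path E p a b" shows "a \<in> cells E 0" "b \<in> cells E 0"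
  using assms face_1_in[OF E] by (auto simp: fibre_path_def)

lemma fibre_path_euclid:
  assumes "fibre_path E p a b" "fibre_path E p a c" shows "fibre_path E p b c"
proof -
  obtain u where u: "u \<in> cells E 1" "face E 1 1 u = a" "face E 1 0 u = b" "p 1 u = p 1 (const_cell E 1 a)"
    using assms(1) by (auto simp: fibre_path_def)
  obtain v where v: "v \<in> cells E 1" "face E 1 1 v = a" "face E 1 0 v = c" "p 1 v = p 1 (const_cell E 1 a)"
    using assms(2) by (auto simp: fibre_path_def)
  show ?thesis using ends_connected[of u v] u v by simp
qed

lemma fibre_path_sym: "fibre_path E p a b \<Longrightarrow> fibre_path E p b a"
  using fibre_path_euclid[of a b a] fibre_path_refl[OF E, of a p] fibre_path_in by blast

lemma fibre_path_trans: "\<lbrakk>fibre_path E p a b; fibre_path E p b c\<rbrakk> \<Longrightarrow> fibre_path E p a c"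
  using fibre_path_euclid fibre_path_sym by blast

text \<open>
  A path \<open>w\<close> in the fibre between two starting (or end) points is combined with \<open>u\<close> into an edge \<open>u'\<close>
  over the same edge of the base that shares a vertex with \<open>v\<close>; this reduces to the previous cases.
\<close>

lemma fibre_path_transport:
  assumes uv: "u \<in> cells E 1" "v \<in> cells E 1" "p 1 u = p 1 v"
  shows "fibre_path E p (face E 1 1 u) (face E 1 1 v) \<longleftrightarrow> fibre_path E p (face E 1 0 u) (face E 1 0 v)"
proof
  assume "fibre_path E p (face E 1 1 u) (face E 1 1 v)"
  then obtain w where w: "w \<in> cells E 1" "face E 1 1 w = face E 1 1 u" "face E 1 0 w = face E 1 1 v"
    "p 1 w = p 1 (const_cell E 1 (face E 1 1 u))" by (auto simp: fibre_path_def)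
  obtain u' where u': "u' \<in> cells E 1" "face E 1 1 u' = face E 1 1 v" "face E 1 0 u' = face E 1 0 u" "p 1 u' = p 1 u"
    using refill_0[OF face_degen(1)[OF E uv(1) zero_le] w(1) uv(1) w(2), unfolded face_degen(2-)[OF E uv(1)],
        OF w(4) refl] w(3) by auto
  then show "fibre_path E p (face E 1 0 u) (face E 1 0 v)"
    using ends_connected[of u' v] uv by simp
next
  assume "fibre_path E p (face E 1 0 u) (face E 1 0 v)"
  then obtain w where w: "w \<in> cells E 1" "face E 1 1 w = face E 1 0 u" "face E 1 0 w = face E 1 0 v"
    "p 1 w = p 1 (const_cell E 1 (face E 1 0 u))" by (auto simp: fibre_path_def)
  obtain u' where u': "u' \<in> cells E 1" "face E 1 1 u' = face E 1 1 u" "face E 1 0 u' = face E 1 0 v" "p 1 u' = p 1 u"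
    using refill_1[OF face_degen(1)[OF E uv(1) le_refl] uv(1) w(1) w(2)[symmetric], unfolded face_degen(2-)[OF E uv(1)],
        OF refl w(4)] w(3) by auto
  then show "fibre_path E p (face E 1 1 u) (face E 1 1 v)"
    using starts_connected[of u' v] uv by simp
qed

end

section \<open>Path components\<close>

definition edge_rel :: "'a sset \<Rightarrow> ('a \<times> 'a) set" where
  "edge_rel A = {(face A 1 1 e, face A 1 0 e) |e. e \<in> cells A 1} \<union>
     {(face A 1 0 e, face A 1 1 e) |e. e \<in> cells A 1}"

lemma pi0_rel_iff: "(a, b) \<in> pi0_rel A \<longleftrightarrow> a \<in> cells A 0 \<and> b \<in> cells A 0 \<and> (a, b) \<in> (edge_rel A)\<^sup>*"
  by (simp add: pi0_rel_def edge_rel_def)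

text \<open>
  Transport along a zigzag: the form in which membership of the generated equivalence relation is used.
\<close>

lemma pi0_rel_invariant:
  assumes P: "\<And>e. e \<in> cells A 1 \<Longrightarrow> P (face A 1 1 e) \<longleftrightarrow> P (face A 1 0 e)" and ab: "(a, b) \<in> pi0_rel A"
  shows "P a \<longleftrightarrow> P b"
proof -
  have "(a, b) \<in> (edge_rel A)\<^sup>*"
    using ab by (simp add: pi0_rel_iff)
  then show ?thesis
  proof (induction rule: rtrancl_induct)
    case (step b c)
    have "P b \<longleftrightarrow> P c" using step(2) P by (auto simp: edge_rel_def)
    with step(3) show ?case by simp
  qed simp
qed

lemma pi0_rel_refl: "a \<in> cells A 0 \<Longrightarrow> (a, a) \<in> pi0_rel A"
  by (simp add: pi0_rel_iff)

lemma pi0_rel_trans: "\<lbrakk>(a, b) \<in> pi0_rel A; (b, c) \<in> pi0_rel A\<rbrakk> \<Longrightarrow> (a, c) \<in> pi0_rel A"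
  by (simp only: pi0_rel_iff) (meson rtrancl_trans)

lemma pi0_rel_sym: "(a, b) \<in> pi0_rel A \<Longrightarrow> (b, a) \<in> pi0_rel A"
proof -
  have "sym ((edge_rel A)\<^sup>*)"
    by (rule sym_rtrancl) (auto simp: sym_def edge_rel_def)
  then show "(a, b) \<in> pi0_rel A \<Longrightarrow> (b, a) \<in> pi0_rel A"
    by (simp only: pi0_rel_iff) (meson symD)
qed

lemma pi0_rel_edge:
  assumes "simplicial_set A" "e \<in> cells A 1" shows "(face A 1 1 e, face A 1 0 e) \<in> pi0_rel A"
proof -
  have "(face A 1 1 e, face A 1 0 e) \<in> edge_rel A" using assms(2) unfolding edge_rel_def by blast
  then have "(face A 1 1 e, face A 1 0 e) \<in> (edge_rel A)\<^sup>*" by (rule r_into_rtrancl)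
  then show ?thesis using assms by (simp add: pi0_rel_iff face_1_in)
qed

lemma pi0_rel_map:
  assumes f: "simplicial_map A B f" and A: "simplicial_set A" and B: "simplicial_set B"
    and ab: "(a, b) \<in> pi0_rel A"
  shows "(f 0 a, f 0 b) \<in> pi0_rel B"
proof -
  have step: "(f 0 a, f 0 (face A 1 1 e)) \<in> pi0_rel B \<longleftrightarrow> (f 0 a, f 0 (face A 1 0 e)) \<in> pi0_rel B"
    if "e \<in> cells A 1" for e
  proof -
    have "(f 0 (face A 1 1 e), f 0 (face A 1 0 e)) \<in> pi0_rel B"
      using pi0_rel_edge[OF B simplicial_map_in[OF f that]] that
        simplicial_map_face[OF f, of 1 0 e] simplicial_map_face[OF f, of 1 1 e] by simp
    then show ?thesis
      by (meson pi0_rel_trans pi0_rel_sym)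
  qed
  have "(f 0 a, f 0 a) \<in> pi0_rel B"
    using ab f by (simp add: pi0_rel_iff pi0_rel_refl simplicial_map_in)
  moreover have "(f 0 a, f 0 a) \<in> pi0_rel B \<longleftrightarrow> (f 0 a, f 0 b) \<in> pi0_rel B"
    by (rule pi0_rel_invariant[OF _ ab, of "\<lambda>c. (f 0 a, f 0 c) \<in> pi0_rel B"]) (rule step)
  ultimately show ?thesis by simp
qed

text \<open>
  A simplicial map preserves the relation, so the image of a whole class generates the same class as
  the image of any one representative; this turns the bijection of classes into statements on vertices.
\<close>

lemma weak_equivalence_pi0:
  assumes A: "simplicial_set A" and B: "simplicial_set B" and f: "weak_equivalence A B f"
  shows "\<lbrakk>a \<in> cells A 0; a' \<in> cells A 0; f 0 a = f 0 a'\<rbrakk> \<Longrightarrow> (a, a') \<in> pi0_rel A"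
    and "b \<in> cells B 0 \<Longrightarrow> \<exists>a\<in>cells A 0. (f 0 a, b) \<in> pi0_rel B"
proof -
  have sm: "simplicial_map A B f"
    and bij: "bij_betw (\<lambda>c. pi0_rel B `` (f 0 ` c)) (pi0 A) (pi0 B)"
    using f by (auto simp: weak_equivalence_def)
  have im: "pi0_rel B `` (f 0 ` (pi0_rel A `` {a})) = pi0_rel B `` {f 0 a}" if "a \<in> cells A 0" for a
  proof
    show "pi0_rel B `` {f 0 a} \<subseteq> pi0_rel B `` (f 0 ` (pi0_rel A `` {a}))"
      using ImageI[OF _ imageI[of a _ "f 0"]] pi0_rel_refl[OF that] by auto
    show "pi0_rel B `` (f 0 ` (pi0_rel A `` {a})) \<subseteq> pi0_rel B `` {f 0 a}"
    proof
      fix c assume "c \<in> pi0_rel B `` (f 0 ` (pi0_rel A `` {a}))"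
      then obtain b where "(a, b) \<in> pi0_rel A" "(f 0 b, c) \<in> pi0_rel B" by blast
      then show "c \<in> pi0_rel B `` {f 0 a}"
        using pi0_rel_trans[OF pi0_rel_map[OF sm A B, of a b], of c] by simp
    qed
  qed
  show "(a, a') \<in> pi0_rel A" if "a \<in> cells A 0" "a' \<in> cells A 0" "f 0 a = f 0 a'"
  proof -
    have inj: "inj_on (\<lambda>c. pi0_rel B `` (f 0 ` c)) (pi0 A)" using bij by (simp add: bij_betw_def)
    have "pi0_rel A `` {a} \<in> pi0 A" "pi0_rel A `` {a'} \<in> pi0 A"
      using that by (simp_all add: pi0_def quotientI)
    then have "pi0_rel A `` {a} = pi0_rel A `` {a'}"
      using inj_onD[OF inj, of "pi0_rel A `` {a}" "pi0_rel A `` {a'}"] im[OF that(1)] im[OF that(2)] that(3)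
      by metis
    moreover have "a' \<in> pi0_rel A `` {a'}" using pi0_rel_refl[OF that(2)] by simp
    ultimately have "a' \<in> pi0_rel A `` {a}" by simp
    then show ?thesis by simp
  qed
  show "\<exists>a\<in>cells A 0. (f 0 a, b) \<in> pi0_rel B" if b: "b \<in> cells B 0"
  proof -
    have "(\<lambda>c. pi0_rel B `` (f 0 ` c)) ` pi0 A = pi0 B" using bij by (simp add: bij_betw_def)
    moreover have "pi0_rel B `` {b} \<in> pi0 B" using b by (simp add: pi0_def quotientI)
    ultimately obtain c where c: "c \<in> pi0 A" "pi0_rel B `` {b} = pi0_rel B `` (f 0 ` c)" by blast
    obtain a where a: "a \<in> cells A 0" "c = pi0_rel A `` {a}"
      using c(1) unfolding pi0_def by (rule quotientE)
    have "pi0_rel B `` {b} = pi0_rel B `` {f 0 a}" using c(2) im[OF a(1)] a(2) by simp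
    moreover have "b \<in> pi0_rel B `` {b}" using pi0_rel_refl[OF b] by simp
    ultimately have "(f 0 a, b) \<in> pi0_rel B" by simp
    then show ?thesis using a(1) by (rule bexI)
  qed
qed

section \<open>Bisimplicial sets\<close>

locale bisimplicial =
  fixes X :: "'a bisset"
  assumes X: "bisimplicial_set X"
begin

lemma bact_in:
  "\<lbrakk>x \<in> bcells X n m; \<alpha> \<in> ord_maps k n; \<theta> \<in> ord_maps l m\<rbrakk> \<Longrightarrow> bact X k l n m \<alpha> \<theta> x \<in> bcells X k l"
  using X by (simp add: bisimplicial_set_def)

lemma bact_id: "x \<in> bcells X n m \<Longrightarrow> bact X n m n m (ord_id n) (ord_id m) x = x"
  using X by (simp add: bisimplicial_set_def)

lemma bact_bact:
  "\<lbrakk>x \<in> bcells X n m; \<alpha> \<in> ord_maps k n; \<theta> \<in> ord_maps l m; \<beta> \<in> ord_maps p k; \<phi> \<in> ord_maps q l\<rbrakk>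
   \<Longrightarrow> bact X p q k l \<beta> \<phi> (bact X k l n m \<alpha> \<theta> x) =
       bact X p q n m (compose {..p} \<alpha> \<beta>) (compose {..q} \<theta> \<phi>) x"
  using X by (simp add: bisimplicial_set_def)

lemma cells_column [simp]: "cells (column X n) = bcells X n"
  by (simp add: column_def)

lemma act_column: "act (column X n) l m \<theta> = bact X n l n m (ord_id n) \<theta>"
  by (simp add: column_def)

lemma column: "simplicial_set (column X n)"
  by (rule simplicial_set_column[OF X])

lemma hface_in: "\<lbrakk>x \<in> bcells X n m; 1 \<le> n; i \<le> n\<rbrakk> \<Longrightarrow> hface X n i m x \<in> bcells X (n - 1) m"
  by (simp add: hface_def bact_in coface_in ord_id_in)

lemma hdegen_in: "\<lbrakk>x \<in> bcells X n m; i \<le> n\<rbrakk> \<Longrightarrow> hdegen X n i m x \<in> bcells X (Suc n) m"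
  by (simp add: hdegen_def bact_in codegen_in ord_id_in)

lemma bact_hface:
  "\<lbrakk>x \<in> bcells X n m; 1 \<le> n; i \<le> n; \<beta> \<in> ord_maps p (n - 1); \<phi> \<in> ord_maps q m\<rbrakk>
   \<Longrightarrow> bact X p q (n - 1) m \<beta> \<phi> (hface X n i m x) = bact X p q n m (compose {..p} (coface n i) \<beta>) \<phi> x"
  by (simp add: hface_def bact_bact coface_in ord_id_in ord_comp_id_left)

lemma hface_act:
  assumes "x \<in> bcells X n m" "1 \<le> n" "i \<le> n" "\<theta> \<in> ord_maps l m"
  shows "hface X n i l (act (column X n) l m \<theta> x) = act (column X (n - 1)) l m \<theta> (hface X n i m x)"
  using assms coface_in[of n i]
  by (simp add: act_column bact_hface ord_id_in) 
    (simp add: hface_def bact_bact ord_id_in ord_comp_id_left ord_comp_id_right)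

lemma hface_face:
  assumes "x \<in> bcells X n 1" "1 \<le> n" "i \<le> n" "j \<le> 1"
  shows "hface X n i 0 (face (column X n) 1 j x) = face (column X (n - 1)) 1 j (hface X n i 1 x)"
  using assms hface_act[of x n 1 i "coface 1 j" 0] coface_in[of 1 j] by (simp add: face_def)

lemma hface_const:
  assumes "x \<in> bcells X n 0" "1 \<le> n" "i \<le> n"
  shows "hface X n i m (const_cell (column X n) m x) = const_cell (column X (n - 1)) m (hface X n i 0 x)"
  using assms by (simp add: const_cell_def hface_act const_in)

lemma hface_hface:
  assumes x: "x \<in> bcells X (Suc (Suc n)) m" and ij: "i < j" "j \<le> Suc (Suc n)"
  shows "hface X (Suc n) i m (hface X (Suc (Suc n)) j m x) = hface X (Suc n) (j - 1) m (hface X (Suc (Suc n)) i m x)"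
proof -
  have "hface X (Suc n) k m (hface X (Suc (Suc n)) l m x) =
      bact X n m (Suc (Suc n)) m (compose {..n} (coface (Suc (Suc n)) l) (coface (Suc n) k)) (ord_id m) x"
    if "k \<le> Suc n" "l \<le> Suc (Suc n)" for k l
    using bact_hface[OF x, of l "coface (Suc n) k" n "ord_id m" m, unfolded diff_Suc_1] coface_in[of "Suc n" k] that
    by (simp add: hface_def[of X "Suc n"] ord_id_in)
  moreover have "compose {..n} (coface (Suc (Suc n)) j) (coface (Suc n) i) =
      compose {..n} (coface (Suc (Suc n)) i) (coface (Suc n) (j - 1))"
    using ij by (auto simp: compose_def coface_def fun_eq_iff)
  ultimately show ?thesis using ij by simp
qed

lemma hface_hface_2:
  "\<lbrakk>x \<in> bcells X 2 m; i < j; j \<le> 2\<rbrakk> \<Longrightarrow> hface X 1 i m (hface X 2 j m x) = hface X 1 (j - 1) m (hface X 2 i m x)"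
  using hface_hface[of x 0 m i j] by (simp)

lemma hface_hface_3:
  "\<lbrakk>x \<in> bcells X 3 m; i < j; j \<le> 3\<rbrakk> \<Longrightarrow> hface X 2 i m (hface X 3 j m x) = hface X 2 (j - 1) m (hface X 3 i m x)"
  using hface_hface[of x 1 m i j] by (simp)

lemma hface_hdegen:
  assumes x: "x \<in> bcells X n m" and ij: "i \<le> n" "j \<le> Suc n"
  shows "hface X (Suc n) j m (hdegen X n i m x) = bact X n m n m (compose {..n} (codegen n i) (coface (Suc n) j)) (ord_id m) x"
  using assms bact_bact[OF x codegen_in[OF ij(1)] ord_id_in coface_in[of "Suc n" j] ord_id_in]
  by (simp add: hface_def hdegen_def ord_comp_id_left[OF ord_id_in])

lemma hface_hdegen_id:
  assumes x: "x \<in> bcells X n m" and ij: "i \<le> n" "j = i \<or> j = Suc i"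
  shows "hface X (Suc n) j m (hdegen X n i m x) = x"
proof -
  have "compose {..n} (codegen n i) (coface (Suc n) j) = ord_id n"
    using ij by (auto simp: compose_def coface_def codegen_def ord_id_def fun_eq_iff)
  then show ?thesis using x ij by (auto simp: hface_hdegen bact_id)
qed

lemma hface_hdegen_1:
  assumes f: "f \<in> bcells X 1 m"
  shows "hface X 2 2 m (hdegen X 1 0 m f) = hdegen X 0 0 m (hface X 1 1 m f)"
    and "hface X 2 0 m (hdegen X 1 1 m f) = hdegen X 0 0 m (hface X 1 0 m f)"
proof -
  have 1: "hface X 2 j m (hdegen X 1 i m f) = bact X 1 m 1 m (compose {..1} (codegen 1 i) (coface 2 j)) (ord_id m) f"
    if "i \<le> 1" "j \<le> 2" for i j
    using hface_hdegen[OF f, of i j] that by (simp)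
  have 2: "hdegen X 0 0 m (hface X 1 j m f) = bact X 1 m 1 m (compose {..1} (coface 1 j) (codegen 0 0)) (ord_id m) f"
    if "j \<le> 1" for j
    using bact_hface[OF f, of j "codegen 0 0" 1 "ord_id m" m] codegen_in[of 0 0] that
    by (simp add: hdegen_def ord_id_in)
  have "compose {..1} (codegen 1 0) (coface 2 2) = compose {..1} (coface 1 1) (codegen 0 0)"
    "compose {..1} (codegen 1 1) (coface 2 0) = compose {..1} (coface 1 0) (codegen 0 0)"
    by (auto simp: compose_def coface_def codegen_def fun_eq_iff)
  then show "hface X 2 2 m (hdegen X 1 0 m f) = hdegen X 0 0 m (hface X 1 1 m f)"
    and "hface X 2 0 m (hdegen X 1 1 m f) = hdegen X 0 0 m (hface X 1 0 m f)"
    by (simp_all add: 1 2)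
qed

text \<open>
  The boundary of \<open>\<Delta>\<^sup>1\<close> consists of two points, so that the matching map for \<open>n = 1\<close> carries exactly the
  information of the source and the target. Indeed, an operator into \<open>[1]\<close> that misses a point is
  constant and hence factors through a coface.
\<close>

lemma matching_map_eq_iff:
  assumes x: "x \<in> bcells X 1 m" "x' \<in> bcells X 1 m"
  shows "matching_map X 1 m x = matching_map X 1 m x' \<longleftrightarrow> (\<forall>i\<le>1. hface X 1 i m x = hface X 1 i m x')"
    (is "?L \<longleftrightarrow> ?R")
proof (rule iffI)
  have *: "matching_map X 1 m x p q (\<alpha>, \<theta>) = bact X p q 1 m \<alpha> \<theta> x"
    if "\<alpha> \<in> ord_maps p 1" "\<alpha> ` {..p} \<noteq> {..1}" "\<theta> \<in> ord_maps q m" for x p q \<alpha> \<theta>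
    using that by (simp add: matching_map_def ldiv_restrict_def yoneda_def box_def simplex_boundary_def std_simplex_def)
  show ?R if L: ?L
  proof (intro allI impI)
    fix i :: nat assume i: "i \<le> 1"
    have "i \<notin> coface 1 i ` {..0}" by (auto simp: coface_def)
    moreover have "i \<in> {..1}" using i by simp
    ultimately have "coface 1 i ` {..0} \<noteq> {..1}" by metis
    then have "matching_map X 1 m y 0 m (coface 1 i, ord_id m) = hface X 1 i m y" for y
      using i coface_in[of 1 i] by (simp add: * ord_id_in hface_def)
    from this[of x] this[of x'] show "hface X 1 i m x = hface X 1 i m x'" by (simp only: L)
  qed
  assume R: ?R
  have key: "bact X p q 1 m \<alpha> \<theta> x = bact X p q 1 m \<alpha> \<theta> x'"
    if \<alpha>: "\<alpha> \<in> ord_maps p 1" "\<alpha> ` {..p} \<noteq> {..1}" "\<theta> \<in> ord_maps q m" for p q \<alpha> \<theta>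
  proof -
    have "\<alpha> \<in> {..p} \<rightarrow>\<^sub>E {..1}" using \<alpha> by (simp add: ord_maps_def)
    then have sub: "\<alpha> ` {..p} \<subseteq> {..1}" by auto
    then obtain i where i: "i \<le> 1" "i \<notin> \<alpha> ` {..p}" using \<alpha>(2) by (auto simp del: image_subset_iff)
    have "\<alpha> j = 1 - i" if "j \<le> p" for j
    proof -
      have "\<alpha> j \<le> 1" "\<alpha> j \<noteq> i" using sub i that by auto
      then show ?thesis using i(1) by linarith
    qed
    then have "\<alpha> = compose {..p} (coface 1 i) (\<lambda>j\<in>{..p}. 0)"
      using i \<open>\<alpha> \<in> {..p} \<rightarrow>\<^sub>E {..1}\<close>
      by (auto simp: compose_def coface_def fun_eq_iff PiE_iff extensional_def)
    then have "bact X p q 1 m \<alpha> \<theta> y = bact X p q 0 m (\<lambda>j\<in>{..p}. 0) \<theta> (hface X 1 i m y)"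
      if "y \<in> bcells X 1 m" for y
      using bact_hface[OF that, of i "\<lambda>j\<in>{..p}. 0" p \<theta> q] i \<alpha> const_in[of p] by simp
    then show ?thesis using x R i by simp
  qed
  show ?L
  proof (intro ext)
    fix p q and z :: "(nat \<Rightarrow> nat) \<times> (nat \<Rightarrow> nat)"
    obtain \<alpha> \<theta> where z: "z = (\<alpha>, \<theta>)" by (cases z)
    show "matching_map X 1 m x p q z = matching_map X 1 m x' p q z"
    proof (cases "\<alpha> \<in> ord_maps p 1 \<and> \<alpha> ` {..p} \<noteq> {..1} \<and> \<theta> \<in> ord_maps q m")
      case True
      then show ?thesis by (simp add: z * key)
    next
      case False
      then have "z \<notin> bcells (box (simplex_boundary 1) (std_simplex m)) p q"
        by (auto simp: z box_def simplex_boundary_def std_simplex_def)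
      then show ?thesis by (simp add: matching_map_def ldiv_restrict_def)
    qed
  qed
qed

end

section \<open>Stars of edges\<close>

text \<open>
  \<open>leg i : [1] \<rightarrow> [n]\<close> is the edge \<open>{0, i}\<close> of \<open>\<Delta>\<^sup>n\<close>. An operator \<open>\<alpha>\<close> with image in \<open>{0, i}\<close> factors
  through it by \<open>collapse p \<alpha>\<close>, which does not depend on \<open>i\<close>.
\<close>

definition leg :: "nat \<Rightarrow> nat \<Rightarrow> nat" where
  "leg i = (\<lambda>j\<in>{..1}. if j = 0 then 0 else i)"

definition collapse :: "nat \<Rightarrow> (nat \<Rightarrow> nat) \<Rightarrow> nat \<Rightarrow> nat" where
  "collapse p \<alpha> = (\<lambda>j\<in>{..p}. if \<alpha> j = 0 then 0 else 1)"

lemma leg_in: "i \<le> n \<Longrightarrow> leg i \<in> ord_maps 1 n"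
  by (auto simp: leg_def ord_maps_def mono_on_def)

lemma leg_coface: "leg 1 = coface 2 2" "leg 2 = coface 2 1"
  by (auto simp: leg_def coface_def fun_eq_iff)

lemma leg_coface_0: "compose {..0} (leg i) (coface 1 1) = (\<lambda>j\<in>{..0}. 0)"
  by (auto simp: leg_def coface_def compose_def fun_eq_iff)

lemma mono_on_atMost_last: "\<lbrakk>\<alpha> \<in> ord_maps p n; j \<le> p\<rbrakk> \<Longrightarrow> \<alpha> j \<le> \<alpha> p"
  by (auto simp: ord_maps_def mono_on_def)

lemma collapse_in:
  assumes "\<alpha> \<in> ord_maps p n" shows "collapse p \<alpha> \<in> ord_maps p 1"
proof -
  have "\<alpha> i \<le> \<alpha> j" if "i \<le> j" "j \<le> p" for i j
    using assms that by (auto simp: ord_maps_def mono_on_def)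
  then show ?thesis
    by (fastforce simp: collapse_def ord_maps_def mono_on_def)
qed

text \<open>
  An operator that is constantly \<open>0\<close> lies on every leg; its collapse then factors through the vertex
  \<open>0\<close>, where the legs are glued.
\<close>

lemma collapse_zero: "\<lbrakk>\<alpha> \<in> ord_maps p n; \<alpha> p = 0\<rbrakk> \<Longrightarrow> collapse p \<alpha> = compose {..p} (coface 1 1) (\<lambda>j\<in>{..p}. 0)"
  using mono_on_atMost_last[of \<alpha> p n] by (auto simp: collapse_def compose_def coface_def fun_eq_iff)

lemma collapse_compose:
  assumes "\<beta> \<in> ord_maps k p"
  shows "collapse k (compose {..k} \<alpha> \<beta>) = compose {..k} (collapse p \<alpha>) \<beta>"
  using assms by (auto simp: collapse_def compose_def fun_eq_iff ord_maps_def)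

lemma leg_collapse:
  assumes "\<alpha> \<in> ord_maps p n" "\<alpha> ` {..p} \<subseteq> {0, i}"
  shows "\<alpha> = compose {..p} (leg i) (collapse p \<alpha>)"
  using assms by (auto simp: collapse_def compose_def leg_def fun_eq_iff ord_maps_def PiE_iff extensional_def)

lemma collapse_leg: "0 < i \<Longrightarrow> collapse 1 (leg i) = ord_id 1"
  by (auto simp: collapse_def leg_def ord_id_def fun_eq_iff)

lemma star_edges_cells:
  "cells (star_edges n) p = {\<alpha> \<in> ord_maps p n. \<exists>i. 0 < i \<and> i \<le> n \<and> \<alpha> ` {..p} \<subseteq> {0, i}}"
  by (simp add: star_edges_def)

lemma star_edges_act: "act (star_edges n) l p \<beta> \<alpha> = compose {..l} \<alpha> \<beta>"
  by (simp add: star_edges_def std_simplex_def)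

lemma star_edges_compose:
  assumes "\<alpha> \<in> cells (star_edges n) p" "\<beta> \<in> ord_maps k p"
  shows "compose {..k} \<alpha> \<beta> \<in> cells (star_edges n) k"
proof -
  have "compose {..k} \<alpha> \<beta> ` {..k} \<subseteq> \<alpha> ` {..p}"
    using assms(2) by (auto simp: compose_def ord_maps_def)
  then show ?thesis using assms ord_comp_in[of \<beta> k p \<alpha> n] by (fastforce simp: star_edges_cells)
qed

lemma simplicial_set_star_edges: "simplicial_set (star_edges n)"
proof -
  have "\<alpha> \<in> ord_maps p n" if "\<alpha> \<in> cells (star_edges n) p" for \<alpha> p
    using that by (simp add: star_edges_cells)
  then have "compose {..p} \<alpha> (ord_id p) = \<alpha>" if "\<alpha> \<in> cells (star_edges n) p" for \<alpha> p
    using that ord_comp_id_right by blast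
  then show ?thesis
    by (simp add: simplicial_set_def star_edges_act star_edges_compose ord_comp_assoc)
qed

lemma leg_in_star: "\<lbrakk>0 < i; i \<le> n\<rbrakk> \<Longrightarrow> leg i \<in> cells (star_edges n) 1"
  using leg_in[of i n] by (auto simp: star_edges_cells leg_def)

context bisimplicial
begin

lemma simplicial_set_star_maps: "simplicial_set (ldiv (star_edges n) X)"
  by (rule simplicial_set_ldiv[OF X simplicial_set_star_edges])

lemma star_map_in:
  "\<lbrakk>\<xi> \<in> cells (ldiv (star_edges n) X) m; \<alpha> \<in> cells (star_edges n) p; \<theta> \<in> ord_maps q m\<rbrakk>
   \<Longrightarrow> \<xi> p q (\<alpha>, \<theta>) \<in> bcells X p q"
  by (auto simp: ldiv_def bisimplicial_maps_def box_def std_simplex_def)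

lemma star_map_bact:
  "\<lbrakk>\<xi> \<in> cells (ldiv (star_edges n) X) m; \<alpha> \<in> cells (star_edges n) p; \<theta> \<in> ord_maps q m;
    \<beta> \<in> ord_maps k p; \<phi> \<in> ord_maps l q\<rbrakk>
   \<Longrightarrow> bact X k l p q \<beta> \<phi> (\<xi> p q (\<alpha>, \<theta>)) = \<xi> k l (compose {..k} \<alpha> \<beta>, compose {..l} \<theta> \<phi>)"
  by (auto simp: ldiv_def bisimplicial_maps_def box_def std_simplex_def star_edges_act)

lemma star_map_leg_source:
  assumes "\<xi> \<in> cells (ldiv (star_edges n) X) m" "0 < i" "i \<le> n"
  shows "hface X 1 1 m (\<xi> 1 m (leg i, ord_id m)) = \<xi> 0 m (\<lambda>j\<in>{..0}. 0, ord_id m)"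
  using star_map_bact[OF assms(1) leg_in_star[OF assms(2,3)] ord_id_in coface_in[of 1 1] ord_id_in]
  by (simp add: hface_def leg_coface_0 ord_comp_id_left ord_id_in del: atMost_0)

lemma star_map_leg_face:
  assumes \<xi>: "\<xi> \<in> cells (ldiv (star_edges n) X) 1" and i: "0 < i" "i \<le> n" and j: "j \<le> 1"
  shows "face (column X 1) 1 j (\<xi> 1 1 (leg i, ord_id 1)) = face (ldiv (star_edges n) X) 1 j \<xi> 1 0 (leg i, ord_id 0)"
proof -
  have c: "coface 1 j \<in> ord_maps 0 1" using coface_in[of 1 j] j by simp
  have "face (column X 1) 1 j (\<xi> 1 1 (leg i, ord_id 1)) = \<xi> 1 0 (leg i, coface 1 j)"
    using star_map_bact[OF \<xi> leg_in_star[OF i] ord_id_in ord_id_in c] c leg_in[OF i(2)]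
    by (simp add: face_def act_column ord_comp_id_left ord_comp_id_right del: atMost_0)
  moreover have "face (ldiv (star_edges n) X) 1 j \<xi> 1 0 (leg i, ord_id 0) = \<xi> 1 0 (leg i, coface 1 j)"
    using leg_in_star[OF i] c ord_id_in[of 0] ord_comp_id_right[OF c]
    by (simp add: face_def ldiv_def box_def std_simplex_def del: atMost_0)
  ultimately show ?thesis by simp
qed

text \<open>
  Every family of \<open>n\<close> elements of \<open>X\<^sub>1\<close> with a common source glues to a map on the star \<open>C\<^sub>n\<close>: this is half
  of the identification of \<open>C\<^sub>n \ X\<close> with an iterated fibre product.
\<close>

lemma star_map_exists:
  assumes y: "\<And>i. \<lbrakk>0 < i; i \<le> n\<rbrakk> \<Longrightarrow> y i \<in> bcells X 1 m"
    and v: "\<And>i. \<lbrakk>0 < i; i \<le> n\<rbrakk> \<Longrightarrow> hface X 1 1 m (y i) = v"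
  shows "\<exists>\<xi>\<in>cells (ldiv (star_edges n) X) m. \<forall>i. 0 < i \<and> i \<le> n \<longrightarrow> \<xi> 1 m (leg i, ord_id m) = y i"
proof -
  define val where "val p q \<alpha> \<theta> i = bact X p q 1 m (collapse p \<alpha>) \<theta> (y i)" for p q \<alpha> \<theta> i
  define \<xi> where "\<xi> p q = (\<lambda>(\<alpha>, \<theta>)\<in>bcells (box (star_edges n) (std_simplex m)) p q.
    val p q \<alpha> \<theta> (SOME i. 0 < i \<and> i \<le> n \<and> \<alpha> ` {..p} \<subseteq> {0, i}))" for p q
  \<comment> \<open>The value does not depend on the leg: two different legs meet in the common source only.\<close>
  have unique: "val p q \<alpha> \<theta> i = val p q \<alpha> \<theta> i'"
    if \<alpha>: "\<alpha> \<in> ord_maps p n" "\<theta> \<in> ord_maps q m"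
      and i: "0 < i" "i \<le> n" "\<alpha> ` {..p} \<subseteq> {0, i}" and i': "0 < i'" "i' \<le> n" "\<alpha> ` {..p} \<subseteq> {0, i'}"
    for p q \<alpha> \<theta> i i'
  proof (cases "\<alpha> p = 0")
    case True
    have "val p q \<alpha> \<theta> k = bact X p q 0 m (\<lambda>j\<in>{..p}. 0) \<theta> v" if "0 < k" "k \<le> n" for k
      using bact_hface[OF y[OF that], of 1 "\<lambda>j\<in>{..p}. 0" p \<theta> q] \<alpha> const_in[of p] v[OF that]
      by (simp add: val_def collapse_zero[OF \<alpha>(1) True])
    then show ?thesis using i i' by simp
  next
    case False
    then have "\<alpha> p = i" "\<alpha> p = i'" using i i' by auto
    then show ?thesis by simp
  qed
  have \<xi>: "\<xi> p q (\<alpha>, \<theta>) = val p q \<alpha> \<theta> i"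
    if "\<alpha> \<in> ord_maps p n" "\<theta> \<in> ord_maps q m" "0 < i" "i \<le> n" "\<alpha> ` {..p} \<subseteq> {0, i}" for p q \<alpha> \<theta> i
  proof -
    let ?P = "\<lambda>i. 0 < i \<and> i \<le> n \<and> \<alpha> ` {..p} \<subseteq> {0, i}"
    have "?P (Eps ?P)" using that(3-) by (intro someI[of ?P i]) simp
    then have "val p q \<alpha> \<theta> (Eps ?P) = val p q \<alpha> \<theta> i" using that by (intro unique) auto
    moreover have "(\<alpha>, \<theta>) \<in> bcells (box (star_edges n) (std_simplex m)) p q"
      using that by (auto simp: box_def std_simplex_def star_edges_cells)
    ultimately show ?thesis by (simp add: \<xi>_def)
  qed
  have "\<xi> \<in> bisimplicial_maps (box (star_edges n) (std_simplex m)) X"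
    unfolding bisimplicial_maps_def mem_Collect_eq
  proof (intro conjI allI ballI)
    fix p q
    show "\<xi> p q \<in> bcells (box (star_edges n) (std_simplex m)) p q \<rightarrow>\<^sub>E bcells X p q"
    proof (rule PiE_I)
      fix z assume "z \<in> bcells (box (star_edges n) (std_simplex m)) p q"
      then obtain \<alpha> \<theta> i where z: "z = (\<alpha>, \<theta>)" "\<alpha> \<in> ord_maps p n" "\<theta> \<in> ord_maps q m"
          "0 < i" "i \<le> n" "\<alpha> ` {..p} \<subseteq> {0, i}"
        by (auto simp: box_def std_simplex_def star_edges_cells)
      then show "\<xi> p q z \<in> bcells X p q"
        by (simp only: \<xi>) (simp add: val_def bact_in y collapse_in)
    qed (simp add: \<xi>_def)
  next
    fix k l p q \<beta> \<phi> z
    assume \<beta>: "\<beta> \<in> ord_maps k p" and \<phi>: "\<phi> \<in> ord_maps l q" and "z \<in> bcells (box (star_edges n) (std_simplex m)) p q"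
    then obtain \<alpha> \<theta> i where z: "z = (\<alpha>, \<theta>)" "\<alpha> \<in> ord_maps p n" "\<theta> \<in> ord_maps q m"
        "0 < i" "i \<le> n" "\<alpha> ` {..p} \<subseteq> {0, i}"
      by (auto simp: box_def std_simplex_def star_edges_cells)
    have "compose {..k} \<alpha> \<beta> ` {..k} \<subseteq> \<alpha> ` {..p}"
      using \<beta> by (auto simp: compose_def ord_maps_def)
    then have "\<xi> k l (compose {..k} \<alpha> \<beta>, compose {..l} \<theta> \<phi>) = val k l (compose {..k} \<alpha> \<beta>) (compose {..l} \<theta> \<phi>) i"
      using z \<beta> \<phi> by (intro \<xi>) (auto intro: ord_comp_in)
    also have "\<dots> = bact X k l p q \<beta> \<phi> (val p q \<alpha> \<theta> i)"
      using z \<beta> \<phi> y[of i] collapse_in[of \<alpha> p n] by (simp add: val_def collapse_compose bact_bact)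
    also have "val p q \<alpha> \<theta> i = \<xi> p q z" using \<xi> z by simp
    finally show "\<xi> k l (bact (box (star_edges n) (std_simplex m)) k l p q \<beta> \<phi> z) = bact X k l p q \<beta> \<phi> (\<xi> p q z)"
      by (simp add: z(1) box_def std_simplex_def star_edges_act)
  qed
  moreover have "\<xi> 1 m (leg i, ord_id m) = y i" if "0 < i" "i \<le> n" for i
  proof -
    have "leg i ` {..1} \<subseteq> {0, i}" by (auto simp: leg_def)
    then show ?thesis using that leg_in[of i n] ord_id_in[of m] \<xi>[of "leg i" 1 "ord_id m" m i]
      by (simp add: val_def collapse_leg bact_id y)
  qed
  ultimately show ?thesis by (auto simp: ldiv_def)
qed

lemma bousfield_map_leg:
  assumes "0 < i" "i \<le> n"
  shows "bousfield_map X n m x 1 m (leg i, ord_id m) = bact X 1 m n m (leg i) (ord_id m) x"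
  using leg_in_star[OF assms] leg_in[of i n] ord_id_in[of m] assms
  by (simp add: bousfield_map_def ldiv_restrict_def yoneda_def box_def std_simplex_def)

text \<open>
  The edges \<open>{0, 1}\<close> and \<open>{0, 2}\<close> of \<open>\<Delta>\<^sup>2\<close> are the faces \<open>d\<^sub>2\<close> and \<open>d\<^sub>1\<close>.
\<close>

lemma bousfield_map_2_eqI:
  assumes \<sigma>: "\<sigma> \<in> bcells X 2 m" "\<sigma>' \<in> bcells X 2 m"
    and eq: "hface X 2 1 m \<sigma> = hface X 2 1 m \<sigma>'" "hface X 2 2 m \<sigma> = hface X 2 2 m \<sigma>'"
  shows "bousfield_map X 2 m \<sigma> = bousfield_map X 2 m \<sigma>'"
proof (intro ext)
  fix p q and z :: "(nat \<Rightarrow> nat) \<times> (nat \<Rightarrow> nat)"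
  show "bousfield_map X 2 m \<sigma> p q z = bousfield_map X 2 m \<sigma>' p q z"
  proof (cases "z \<in> bcells (box (star_edges 2) (std_simplex m)) p q")
    case True
    then obtain \<alpha> \<theta> i where z: "z = (\<alpha>, \<theta>)" "\<alpha> \<in> ord_maps p 2" "\<theta> \<in> ord_maps q m"
        "0 < i" "i \<le> 2" "\<alpha> ` {..p} \<subseteq> {0, i}"
      by (auto simp: box_def std_simplex_def star_edges_cells)
    have "i = 1 \<or> i = 2" using z by linarith
    then obtain j where j: "j \<le> 2" "leg i = coface 2 j" "hface X 2 j m \<sigma> = hface X 2 j m \<sigma>'"
      using leg_coface eq by (metis le_refl one_le_numeral)
    have "bousfield_map X 2 m \<tau> p q z = bact X p q 1 m (collapse p \<alpha>) \<theta> (hface X 2 j m \<tau>)"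
      if "\<tau> \<in> bcells X 2 m" for \<tau>
    proof -
      have "bousfield_map X 2 m \<tau> p q z = bact X p q 2 m \<alpha> \<theta> \<tau>"
        using True z by (simp add: bousfield_map_def ldiv_restrict_def yoneda_def box_def std_simplex_def)
      also have "\<dots> = bact X p q 1 m (collapse p \<alpha>) \<theta> (hface X 2 j m \<tau>)"
        using bact_hface[OF that, of j "collapse p \<alpha>" p \<theta> q] z j(1) collapse_in[OF z(2)]
          leg_collapse[OF z(2,6)] j(2) by simp
      finally show ?thesis .
    qed
    then show ?thesis using j(3) \<sigma> by simp
  next
    case False
    then show ?thesis by (simp add: bousfield_map_def ldiv_restrict_def)
  qed
qed

end

section \<open>The fraction operation\<close>

locale bousfield_fractions = bisimplicial X for X :: "'a bisset" +
  fixes mu :: "nat \<Rightarrow> 'a \<times> 'a \<Rightarrow> 'a"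
  assumes segal: "bousfield_segal_space X" and mu: "bousfield_section X mu"
begin

sublocale vertical: kan_fib "column X 1" "ldiv (simplex_boundary 1) X" "matching_map X 1"
  using segal by unfold_locales (auto simp: bousfield_segal_space_def v_fibrant_def column)

abbreviation homotopic (infix "\<simeq>" 50) where
  "a \<simeq> b \<equiv> fibre_path (column X 1) (matching_map X 1) a b"

text \<open>
  For \<open>a\<close> and \<open>b\<close> in \<open>X\<^sub>1(x, y)\<close>, a homotopy is an edge of \<open>X\<^sub>1\<close> whose source and target are degenerate at
  \<open>x\<close> and \<open>y\<close>, that is an edge of \<open>X\<^sub>1(x, y)\<close>.
\<close>

lemma homotopicI:
  assumes e: "e \<in> bcells X 1 1" and a: "a \<in> bcells X 1 0"
    and "face (column X 1) 1 1 e = a" "face (column X 1) 1 0 e = b"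
    and "\<And>i. i \<le> 1 \<Longrightarrow> hface X 1 i 1 e = const_cell (column X 0) 1 (hface X 1 i 0 a)"
  shows "a \<simeq> b"
  using assms const_cell_in[OF column, of a 1 1] matching_map_eq_iff[OF e, of "const_cell (column X 1) 1 a"]
  by (auto simp: fibre_path_def hface_const)

lemma homotopicE:
  assumes "a \<simeq> b"
  obtains e where "e \<in> bcells X 1 1" "a \<in> bcells X 1 0" "b \<in> bcells X 1 0"
    "face (column X 1) 1 1 e = a" "face (column X 1) 1 0 e = b"
    "\<And>i. i \<le> 1 \<Longrightarrow> hface X 1 i 1 e = const_cell (column X 0) 1 (hface X 1 i 0 a)"
proof -
  have ab: "a \<in> bcells X 1 0" "b \<in> bcells X 1 0" using vertical.fibre_path_in[OF assms] by auto
  obtain e where e: "e \<in> bcells X 1 1" "face (column X 1) 1 1 e = a" "face (column X 1) 1 0 e = b"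
    "matching_map X 1 1 e = matching_map X 1 1 (const_cell (column X 1) 1 a)"
    using assms by (auto simp: fibre_path_def)
  have "hface X 1 i 1 e = const_cell (column X 0) 1 (hface X 1 i 0 a)" if "i \<le> 1" for i
    using e that ab const_cell_in[OF column, of a 1 1] matching_map_eq_iff[OF e(1), of "const_cell (column X 1) 1 a"]
    by (simp add: hface_const)
  then show thesis using that e ab by blast
qed

lemma homotopic_refl: "a \<in> bcells X 1 0 \<Longrightarrow> a \<simeq> a"
  by (simp add: fibre_path_refl column)

lemma homotopic_transport:
  assumes uv: "u \<in> bcells X 1 1" "v \<in> bcells X 1 1" and eq: "\<And>i. i \<le> 1 \<Longrightarrow> hface X 1 i 1 u = hface X 1 i 1 v"
  shows "face (column X 1) 1 1 u \<simeq> face (column X 1) 1 1 v \<longleftrightarrow>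
    face (column X 1) 1 0 u \<simeq> face (column X 1) 1 0 v"
  using vertical.fibre_path_transport[of u v] matching_map_eq_iff[OF uv] eq uv by simp

definition divisible :: "nat \<Rightarrow> 'a \<Rightarrow> 'a \<Rightarrow> bool" where
  "divisible m f g \<longleftrightarrow> f \<in> bcells X 1 m \<and> g \<in> bcells X 1 m \<and> hface X 1 1 m f = hface X 1 1 m g"

definition fraction :: "nat \<Rightarrow> 'a \<Rightarrow> 'a \<Rightarrow> 'a" where
  "fraction m f g = hface X 2 0 m (mu m (f, g))"

lemma frac_eq: "frac X mu f g = fraction 0 f g"
  by (simp add: frac_def fraction_def)

lemma mu_filler:
  assumes "divisible m f g"
  shows "mu m (f, g) \<in> bcells X 2 m" "hface X 2 1 m (mu m (f, g)) = f" "hface X 2 2 m (mu m (f, g)) = g"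
proof -
  have "(f, g) \<in> cells (bousfield_pairs X) m"
    using assms by (simp add: divisible_def bousfield_pairs_def)
  then show "mu m (f, g) \<in> bcells X 2 m" "hface X 2 1 m (mu m (f, g)) = f" "hface X 2 2 m (mu m (f, g)) = g"
    using mu by (auto simp: bousfield_section_def simplicial_map_def)
qed

lemma fraction_in: "divisible m f g \<Longrightarrow> fraction m f g \<in> bcells X 1 m"
  using hface_in[of "mu m (f, g)" 2 m 0] mu_filler(1) by (simp add: fraction_def)

lemma hface_fraction:
  assumes "divisible m f g"
  shows "hface X 1 1 m (fraction m f g) = hface X 1 0 m g" "hface X 1 0 m (fraction m f g) = hface X 1 0 m f"
  using hface_hface_2[OF mu_filler(1)[OF assms], of 0 2] hface_hface_2[OF mu_filler(1)[OF assms], of 0 1]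
  by (simp_all add: mu_filler[OF assms] fraction_def)

lemma divisible_faces:
  assumes "\<sigma> \<in> bcells X 2 m" shows "divisible m (hface X 2 1 m \<sigma>) (hface X 2 2 m \<sigma>)"
  using assms hface_in[of \<sigma> 2 m 1] hface_in[of \<sigma> 2 m 2] hface_hface_2[of \<sigma> m 1 2]
  by (simp add: divisible_def)

lemma face_fraction:
  assumes fg: "divisible 1 f g" and j: "j \<le> 1"
  shows "face (column X 1) 1 j (fraction 1 f g) = fraction 0 (face (column X 1) 1 j f) (face (column X 1) 1 j g)"
proof -
  have pair: "(f, g) \<in> cells (bousfield_pairs X) 1"
    using fg by (simp add: divisible_def bousfield_pairs_def)
  have "face (column X 2) 1 j (mu 1 (f, g)) = mu 0 (face (bousfield_pairs X) 1 j (f, g))"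
    using mu simplicial_map_face[of "bousfield_pairs X" "column X 2" mu 1 j "(f, g)"] pair j
    by (simp add: bousfield_section_def)
  also have "face (bousfield_pairs X) 1 j (f, g) = (face (column X 1) 1 j f, face (column X 1) 1 j g)"
    by (simp add: face_def bousfield_pairs_def)
  finally show ?thesis
    using hface_face[OF mu_filler(1)[OF fg], of 0 j] j by (simp add: fraction_def)
qed

text \<open>
  As \<open>mu\<close> is defined on edges, the fraction of two homotopies with a common source makes sense, and it
  is a homotopy between the fractions.
\<close>

lemma fraction_cong:
  assumes f: "f \<simeq> f'" and g: "g \<simeq> g'" and fg: "divisible 0 f g"
  shows "fraction 0 f g \<simeq> fraction 0 f' g'"
proof -
  obtain F where F: "F \<in> bcells X 1 1" "face (column X 1) 1 1 F = f" "face (column X 1) 1 0 F = f'"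
    "\<And>i. i \<le> 1 \<Longrightarrow> hface X 1 i 1 F = const_cell (column X 0) 1 (hface X 1 i 0 f)"
    using homotopicE[OF f] by metis
  obtain G where G: "G \<in> bcells X 1 1" "face (column X 1) 1 1 G = g" "face (column X 1) 1 0 G = g'"
    "\<And>i. i \<le> 1 \<Longrightarrow> hface X 1 i 1 G = const_cell (column X 0) 1 (hface X 1 i 0 g)"
    using homotopicE[OF g] by metis
  have FG: "divisible 1 F G"
    using F G fg by (simp add: divisible_def)
  show ?thesis
  proof (rule homotopicI[OF fraction_in[OF FG] fraction_in[OF fg]])
    fix i :: nat assume "i \<le> 1"
    then have "i = 0 \<or> i = 1" by linarith
    then show "hface X 1 i 1 (fraction 1 F G) = const_cell (column X 0) 1 (hface X 1 i 0 (fraction 0 f g))"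
      using F(4) G(4) by (auto simp: hface_fraction[OF FG] hface_fraction[OF fg])
  qed (simp_all add: face_fraction[OF FG] F G)
qed

text \<open>
  The statement holds for \<open>\<tau> = mu (d\<^sub>1 \<sigma>, d\<^sub>2 \<sigma>)\<close> by definition. Since \<open>\<beta>\<^sub>2\<close> identifies \<open>\<sigma>\<close> and \<open>\<tau>\<close> and is
  injective on \<open>\<pi>\<^sub>0\<close>, a zigzag in \<open>X\<^sub>2\<close> connects them. For an edge \<open>\<delta>\<close> of this zigzag, \<open>d\<^sub>0 \<delta>\<close> and
  \<open>d\<^sub>1 \<delta> / d\<^sub>2 \<delta>\<close> are edges of \<open>X\<^sub>1\<close> with the same source and target, so that the statement can be
  transported along \<open>\<delta>\<close>.
\<close>

lemma fraction_unique:
  assumes \<sigma>: "\<sigma> \<in> bcells X 2 0"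
  shows "hface X 2 0 0 \<sigma> \<simeq> fraction 0 (hface X 2 1 0 \<sigma>) (hface X 2 2 0 \<sigma>)"
proof -
  let ?Q = "\<lambda>\<sigma>. hface X 2 0 0 \<sigma> \<simeq> fraction 0 (hface X 2 1 0 \<sigma>) (hface X 2 2 0 \<sigma>)"
  define \<tau> where "\<tau> = mu 0 (hface X 2 1 0 \<sigma>, hface X 2 2 0 \<sigma>)"
  have \<tau>: "\<tau> \<in> bcells X 2 0" "hface X 2 1 0 \<tau> = hface X 2 1 0 \<sigma>" "hface X 2 2 0 \<tau> = hface X 2 2 0 \<sigma>"
    using mu_filler[OF divisible_faces[OF \<sigma>]] by (simp_all add: \<tau>_def)
  have "bousfield_map X 2 0 \<sigma> = bousfield_map X 2 0 \<tau>"
    using \<sigma> \<tau> by (intro bousfield_map_2_eqI) simp_all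
  moreover have "weak_equivalence (column X 2) (ldiv (star_edges 2) X) (bousfield_map X 2)"
    using segal by (simp add: bousfield_segal_space_def)
  ultimately have path: "(\<sigma>, \<tau>) \<in> pi0_rel (column X 2)"
    using weak_equivalence_pi0(1)[OF column simplicial_set_star_maps] \<sigma> \<tau>(1) by simp
  have step: "?Q (face (column X 2) 1 1 \<delta>) \<longleftrightarrow> ?Q (face (column X 2) 1 0 \<delta>)" if "\<delta> \<in> cells (column X 2) 1" for \<delta>
  proof -
    have \<delta>: "\<delta> \<in> bcells X 2 1" using that by simp
    note fg = divisible_faces[OF \<delta>]
    have end_faces: "hface X 1 i 1 (hface X 2 0 1 \<delta>) = hface X 1 i 1 (fraction 1 (hface X 2 1 1 \<delta>) (hface X 2 2 1 \<delta>))"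
      if "i \<le> 1" for i
    proof -
      have "i = 0 \<or> i = 1" using that by linarith
      then show ?thesis
        using hface_hface_2[OF \<delta>, of 0 2] hface_hface_2[OF \<delta>, of 0 1] by (auto simp: hface_fraction[OF fg])
    qed
    have faces: "hface X 2 i 0 (face (column X 2) 1 j \<delta>) = face (column X 1) 1 j (hface X 2 i 1 \<delta>)"
      if "i \<le> 2" "j \<le> 1" for i j
      using hface_face[OF \<delta>, of i j] that by simp
    have "hface X 2 0 1 \<delta> \<in> bcells X 1 1" using hface_in[OF \<delta>, of 0] by simp
    from homotopic_transport[OF this fraction_in[OF fg] end_faces]
    show ?thesis by (simp add: faces face_fraction[OF fg])
  qed
  have "?Q \<sigma> \<longleftrightarrow> ?Q \<tau>" by (rule pi0_rel_invariant[OF _ path, of ?Q]) (rule step)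
  moreover have "?Q \<tau>"
    using homotopic_refl[OF fraction_in[OF divisible_faces[OF \<sigma>]]] \<tau> by (simp add: \<tau>_def[symmetric] fraction_def)
  ultimately show ?thesis by simp
qed

text \<open>
  The simplex \<open>s\<^sub>0 f\<close> has the faces \<open>f\<close>, \<open>f\<close>, \<open>1\<close>.
\<close>

lemma fraction_unit:
  assumes "f \<in> bcells X 1 0" shows "fraction 0 f (unit_vertex X (hface X 1 1 0 f)) \<simeq> f"
  using fraction_unique[of "hdegen X 1 0 0 f"] assms hdegen_in[OF assms, of 0] hface_hdegen_1(1)[OF assms]
    hface_hdegen_id[OF assms, of 0 0] hface_hdegen_id[OF assms, of 0 1]
  by (simp add: unit_vertex_def vertical.fibre_path_sym)

text \<open>
  The simplex \<open>s\<^sub>1 f\<close> has the faces \<open>1\<close>, \<open>f\<close>, \<open>f\<close>.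
\<close>

lemma fraction_self:
  assumes "f \<in> bcells X 1 0" shows "fraction 0 f f \<simeq> unit_vertex X (hface X 1 0 0 f)"
  using fraction_unique[of "hdegen X 1 1 0 f"] assms hdegen_in[OF assms, of 1] hface_hdegen_1(2)[OF assms]
    hface_hdegen_id[OF assms, of 1 1] hface_hdegen_id[OF assms, of 1 2]
  by (simp add: unit_vertex_def vertical.fibre_path_sym)

lemma divisible_fractions:
  "\<lbrakk>divisible m f h; divisible m g h\<rbrakk> \<Longrightarrow> divisible m (fraction m f h) (fraction m g h)"
  by (simp add: divisible_def[of m "fraction m f h"] fraction_in hface_fraction)

text \<open>
  Let \<open>e\<^sub>i\<^sub>j\<close> denote the edges of \<open>\<Sigma>\<close>, so that \<open>h\<close>, \<open>g\<close>, \<open>f\<close> are \<open>e\<^sub>0\<^sub>1\<close>, \<open>e\<^sub>0\<^sub>2\<close>, \<open>e\<^sub>0\<^sub>3\<close>. The faces \<open>d\<^sub>3\<close>, \<open>d\<^sub>2\<close>, \<open>d\<^sub>1\<close>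
  give \<open>e\<^sub>1\<^sub>2 \<simeq> g / h\<close>, \<open>e\<^sub>1\<^sub>3 \<simeq> f / h\<close> and \<open>e\<^sub>2\<^sub>3 \<simeq> f / g\<close>, while \<open>d\<^sub>0\<close> gives \<open>e\<^sub>2\<^sub>3 \<simeq> e\<^sub>1\<^sub>3 / e\<^sub>1\<^sub>2\<close>.
\<close>

lemma fraction_fractions_3:
  assumes \<Sigma>: "\<Sigma> \<in> bcells X 3 0"
  defines "h \<equiv> hface X 2 2 0 (hface X 3 3 0 \<Sigma>)" and "g \<equiv> hface X 2 1 0 (hface X 3 3 0 \<Sigma>)"
    and "f \<equiv> hface X 2 1 0 (hface X 3 2 0 \<Sigma>)"
  shows "fraction 0 (fraction 0 f h) (fraction 0 g h) \<simeq> fraction 0 f g"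
proof -
  have in2: "hface X 3 i 0 \<Sigma> \<in> bcells X 2 0" if "i \<le> 3" for i
    using hface_in[OF \<Sigma>, of i] that by simp
  note d = hface_hface_3[OF \<Sigma>]
  have q: "hface X 2 0 0 (hface X 3 i 0 \<Sigma>) \<simeq> fraction 0 (hface X 2 1 0 (hface X 3 i 0 \<Sigma>)) (hface X 2 2 0 (hface X 3 i 0 \<Sigma>))"
    if "i \<le> 3" for i
    by (rule fraction_unique[OF in2[OF that]])
  have q3: "hface X 2 0 0 (hface X 3 3 0 \<Sigma>) \<simeq> fraction 0 g h"
    using q[of 3] by (simp add: g_def h_def)
  have q2: "hface X 2 0 0 (hface X 3 2 0 \<Sigma>) \<simeq> fraction 0 f h"
    using q[of 2] d[of 2 3] by (simp add: f_def h_def)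
  have q1: "hface X 2 0 0 (hface X 3 1 0 \<Sigma>) \<simeq> fraction 0 f g"
    using q[of 1] d[of 1 2] d[of 1 3] by (simp add: f_def g_def)
  have q0: "hface X 2 0 0 (hface X 3 1 0 \<Sigma>) \<simeq> fraction 0 (hface X 2 0 0 (hface X 3 2 0 \<Sigma>)) (hface X 2 0 0 (hface X 3 3 0 \<Sigma>))"
    using q[of 0] d[of 0 1] d[of 0 2] d[of 0 3] by simp
  have "divisible 0 (hface X 2 0 0 (hface X 3 2 0 \<Sigma>)) (hface X 2 0 0 (hface X 3 3 0 \<Sigma>))"
    using divisible_faces[OF in2[of 0]] d[of 0 2] d[of 0 3] by simp
  from fraction_cong[OF q2 q3 this] show ?thesis
    using q0 q1 vertical.fibre_path_trans vertical.fibre_path_sym by meson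
qed

text \<open>
  The triple \<open>(h, g, f)\<close> is a vertex of \<open>C\<^sub>3 \ X\<close>. It need not be the star of a simplex, but a zigzag of
  edges connects it to one, since \<open>\<beta>\<^sub>3\<close> is surjective on \<open>\<pi>\<^sub>0\<close>. Along an edge \<open>(H, G, F)\<close> of \<open>C\<^sub>3 \ X\<close> the
  edges \<open>(F / H) / (G / H)\<close> and \<open>F / G\<close> of \<open>X\<^sub>1\<close> both run from the target of \<open>G\<close> to the target of \<open>F\<close>, so
  that the law can be transported.
\<close>

lemma fraction_fractions:
  assumes fh: "divisible 0 f h" and gh: "divisible 0 g h"
  shows "fraction 0 (fraction 0 f h) (fraction 0 g h) \<simeq> fraction 0 f g"
proof -
  define L where "L m i \<xi> = \<xi> 1 m (leg i, ord_id m)" for m i and \<xi> :: "nat \<Rightarrow> nat \<Rightarrow> (nat \<Rightarrow> nat) \<times> (nat \<Rightarrow> nat) \<Rightarrow> 'a"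
  let ?Q = "\<lambda>\<xi>. fraction 0 (fraction 0 (L 0 3 \<xi>) (L 0 1 \<xi>)) (fraction 0 (L 0 2 \<xi>) (L 0 1 \<xi>)) \<simeq> fraction 0 (L 0 3 \<xi>) (L 0 2 \<xi>)"
  have div: "divisible m (L m i \<xi>) (L m j \<xi>)"
    if "\<xi> \<in> cells (ldiv (star_edges 3) X) m" "0 < i" "i \<le> 3" "0 < j" "j \<le> 3" for m i j \<xi>
    using that star_map_in[OF that(1) leg_in_star ord_id_in] star_map_leg_source[OF that(1)]
    by (simp add: divisible_def L_def)
  have step: "?Q (face (ldiv (star_edges 3) X) 1 1 \<eta>) \<longleftrightarrow> ?Q (face (ldiv (star_edges 3) X) 1 0 \<eta>)"
    if \<eta>: "\<eta> \<in> cells (ldiv (star_edges 3) X) 1" for \<eta>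
  proof -
    let ?F = "L 1 3 \<eta>" and ?G = "L 1 2 \<eta>" and ?H = "L 1 1 \<eta>"
    have FH: "divisible 1 ?F ?H" and GH: "divisible 1 ?G ?H" and FG: "divisible 1 ?F ?G"
      using \<eta> by (simp_all add: div)
    note FHGH = divisible_fractions[OF FH GH]
    have faces: "L 0 i (face (ldiv (star_edges 3) X) 1 j \<eta>) = face (column X 1) 1 j (L 1 i \<eta>)"
      if "0 < i" "i \<le> 3" "j \<le> 1" for i j
      using star_map_leg_face[OF \<eta> that] by (simp add: L_def)
    have ends: "hface X 1 i 1 (fraction 1 (fraction 1 ?F ?H) (fraction 1 ?G ?H)) = hface X 1 i 1 (fraction 1 ?F ?G)"
      if "i \<le> 1" for i
    proof -
      have "i = 0 \<or> i = 1" using that by linarith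
      then show ?thesis by (auto simp: hface_fraction FH GH FG FHGH)
    qed
    from homotopic_transport[OF fraction_in[OF FHGH] fraction_in[OF FG] ends]
    show ?thesis by (simp add: faces face_fraction FH GH FG FHGH)
  qed
  define y where "y i = (if i = 1 then h else if i = 2 then g else f)" for i :: nat
  obtain \<xi> where \<xi>: "\<xi> \<in> cells (ldiv (star_edges 3) X) 0" "\<And>i. \<lbrakk>0 < i; i \<le> 3\<rbrakk> \<Longrightarrow> L 0 i \<xi> = y i"
  proof -
    have "y i \<in> bcells X 1 0" "hface X 1 1 0 (y i) = hface X 1 1 0 h" for i
      using fh gh by (simp_all add: y_def divisible_def)
    then show thesis using star_map_exists[of 3 y 0 "hface X 1 1 0 h"] that unfolding L_def by blast
  qed
  have "weak_equivalence (column X 3) (ldiv (star_edges 3) X) (bousfield_map X 3)"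
    using segal by (simp add: bousfield_segal_space_def)
  then obtain \<Sigma> where \<Sigma>: "\<Sigma> \<in> bcells X 3 0" "(bousfield_map X 3 0 \<Sigma>, \<xi>) \<in> pi0_rel (ldiv (star_edges 3) X)"
    using weak_equivalence_pi0(2)[OF column simplicial_set_star_maps _ \<xi>(1)] by auto
  have legs: "L 0 i (bousfield_map X 3 0 \<Sigma>) = hface X 2 j 0 (hface X 3 k 0 \<Sigma>)"
    if "0 < i" "i \<le> 3" "j \<le> 2" "k \<le> 3" "leg i = compose {..1} (coface 3 k) (coface 2 j)" for i j k
    using bousfield_map_leg[OF that(1,2), of 0 \<Sigma>] bact_hface[OF \<Sigma>(1), of k "coface 2 j" 1 "ord_id 0" 0] that
      coface_in[of 2 j] by (simp add: L_def hface_def[of X 2] ord_id_in)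
  have "leg 1 = compose {..1} (coface 3 3) (coface 2 2)" "leg 2 = compose {..1} (coface 3 3) (coface 2 1)"
    "leg 3 = compose {..1} (coface 3 2) (coface 2 1)"
    by (auto simp: leg_def compose_def coface_def fun_eq_iff)
  then have "?Q (bousfield_map X 3 0 \<Sigma>)"
    using fraction_fractions_3[OF \<Sigma>(1)] legs[of 1 2 3] legs[of 2 1 3] legs[of 3 1 2] by simp
  moreover have "?Q (bousfield_map X 3 0 \<Sigma>) \<longleftrightarrow> ?Q \<xi>"
    by (rule pi0_rel_invariant[OF _ \<Sigma>(2), of ?Q]) (rule step)
  ultimately show ?thesis using \<xi>(2) by (simp add: y_def)
qed

end

section \<open>The homotopy groupoid\<close>

context bousfield_fractions
begin

lemma map_space_0:
  assumes "x \<in> bcells X 0 0" "y \<in> bcells X 0 0"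
  shows "f \<in> cells (map_space X x y) 0 \<longleftrightarrow> f \<in> bcells X 1 0 \<and> hface X 1 1 0 f = x \<and> hface X 1 0 0 f = y"
  using assms by (simp add: map_space_def const_cell_0[OF column])

lemma face_map_space: "face (map_space X x y) = face (column X 1)"
  by (simp add: face_def map_space_def fun_eq_iff)

text \<open>
  Homotopy is already an equivalence relation, so that generating one adds nothing.
\<close>

lemma pi0_rel_map_space:
  assumes x: "x \<in> bcells X 0 0" and y: "y \<in> bcells X 0 0"
  shows "(a, b) \<in> pi0_rel (map_space X x y) \<longleftrightarrow>
    a \<in> cells (map_space X x y) 0 \<and> b \<in> cells (map_space X x y) 0 \<and> a \<simeq> b"
proof (intro iffI conjI)
  assume ab: "(a, b) \<in> pi0_rel (map_space X x y)"
  then show a: "a \<in> cells (map_space X x y) 0" and "b \<in> cells (map_space X x y) 0"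
    by (simp_all add: pi0_rel_iff)
  have step: "a \<simeq> face (map_space X x y) 1 1 e \<longleftrightarrow> a \<simeq> face (map_space X x y) 1 0 e"
    if "e \<in> cells (map_space X x y) 1" for e
  proof -
    have e: "e \<in> bcells X 1 1" "hface X 1 1 1 e = const_cell (column X 0) 1 x" "hface X 1 0 1 e = const_cell (column X 0) 1 y"
      using that by (simp_all add: map_space_def)
    have "face (column X 1) 1 1 e \<simeq> face (column X 1) 1 0 e"
    proof (rule homotopicI[OF e(1)])
      show "face (column X 1) 1 1 e \<in> bcells X 1 0" using face_1_in[OF column, of 1 e 1] e by simp
      fix i :: nat assume "i \<le> 1"
      then have "i = 0 \<or> i = 1" by linarith
      then show "hface X 1 i 1 e = const_cell (column X 0) 1 (hface X 1 i 0 (face (column X 1) 1 1 e))"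
        using hface_face[OF e(1), of i 1] e x y by (auto simp: face_const_cell[OF column])
    qed simp_all
    then show ?thesis
      unfolding face_map_space by (meson vertical.fibre_path_trans vertical.fibre_path_sym)
  qed
  have "a \<simeq> a \<longleftrightarrow> a \<simeq> b"
    by (rule pi0_rel_invariant[OF _ ab, of "\<lambda>c. a \<simeq> c"]) (rule step)
  then show "a \<simeq> b" using a by (simp add: map_space_0[OF x y] homotopic_refl)
next
  assume "a \<in> cells (map_space X x y) 0 \<and> b \<in> cells (map_space X x y) 0 \<and> a \<simeq> b"
  then have a: "a \<in> cells (map_space X x y) 0" and b: "b \<in> cells (map_space X x y) 0" and ab: "a \<simeq> b"
    by simp_all
  obtain e where e: "e \<in> bcells X 1 1" "face (column X 1) 1 1 e = a" "face (column X 1) 1 0 e = b"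
    "\<And>i. i \<le> 1 \<Longrightarrow> hface X 1 i 1 e = const_cell (column X 0) 1 (hface X 1 i 0 a)"
    using homotopicE[OF ab] by metis
  have "e \<in> cells (map_space X x y) 1"
    using e(1) e(4)[of 0] e(4)[of 1] a by (simp add: map_space_0[OF x y]) (simp add: map_space_def)
  then have "(a, b) \<in> edge_rel (map_space X x y)"
    using e(2,3) unfolding edge_rel_def face_map_space by blast
  then show "(a, b) \<in> pi0_rel (map_space X x y)"
    using a b by (simp add: pi0_rel_iff r_into_rtrancl)
qed

lemma pi0_class_map_space:
  assumes "x \<in> bcells X 0 0" "y \<in> bcells X 0 0" "f \<in> cells (map_space X x y) 0"
  shows "pi0_class (map_space X x y) f = {g \<in> cells (map_space X x y) 0. f \<simeq> g}"
  using assms by (auto simp: pi0_class_def pi0_rel_map_space)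

lemma pi0_class_eqI:
  assumes "x \<in> bcells X 0 0" "y \<in> bcells X 0 0" "f \<in> cells (map_space X x y) 0" "g \<in> cells (map_space X x y) 0"
    and fg: "f \<simeq> g"
  shows "pi0_class (map_space X x y) f = pi0_class (map_space X x y) g"
proof -
  have "f \<simeq> h \<longleftrightarrow> g \<simeq> h" for h
    using fg by (meson vertical.fibre_path_trans vertical.fibre_path_sym)
  then show ?thesis using assms by (simp add: pi0_class_map_space)
qed

lemma pi0_class_in: "f \<in> cells (map_space X x y) 0 \<Longrightarrow> pi0_class (map_space X x y) f \<in> Ho_B X x y"
  by (simp add: Ho_B_def pi0_def pi0_class_def quotientI)

lemma Ho_B_cases:
  assumes "F \<in> Ho_B X x y"
  obtains f where "f \<in> cells (map_space X x y) 0" "F = pi0_class (map_space X x y) f"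
  using assms unfolding Ho_B_def pi0_def pi0_class_def by (rule quotientE)

lemma map_space_divisible:
  assumes "x \<in> bcells X 0 0" "y \<in> bcells X 0 0" "z \<in> bcells X 0 0"
    and "f \<in> cells (map_space X x y) 0" "g \<in> cells (map_space X x z) 0"
  shows "divisible 0 f g"
  using assms by (simp add: map_space_0 divisible_def)

lemma Ho_frac_class:
  assumes x: "x \<in> bcells X 0 0" and y: "y \<in> bcells X 0 0" and z: "z \<in> bcells X 0 0"
    and f: "f \<in> cells (map_space X x y) 0" and g: "g \<in> cells (map_space X x z) 0"
  shows "Ho_frac X mu x y z (pi0_class (map_space X x y) f) (pi0_class (map_space X x z) g) =
    pi0_class (map_space X z y) (frac X mu f g)"
proof -
  let ?F = "pi0_class (map_space X x y) f" and ?G = "pi0_class (map_space X x z) g"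
  have "pi0_class (map_space X z y) (frac X mu f' g') = pi0_class (map_space X z y) (frac X mu f g)"
    if "f' \<in> ?F" "g' \<in> ?G" for f' g'
  proof -
    have f': "f' \<in> cells (map_space X x y) 0" "f \<simeq> f'" and g': "g' \<in> cells (map_space X x z) 0" "g \<simeq> g'"
      using that assms by (simp_all add: pi0_class_map_space)
    have "frac X mu f g \<simeq> frac X mu f' g'"
      using fraction_cong[OF f'(2) g'(2) map_space_divisible[OF x y z f g]] by (simp add: frac_eq)
    from pi0_class_eqI[OF z y frac_in_map_space[OF X mu f g] frac_in_map_space[OF X mu f'(1) g'(1)] this]
    show ?thesis by simp
  qed
  moreover have "f \<in> ?F" "g \<in> ?G"
    using assms by (simp_all add: pi0_class_map_space map_space_0 homotopic_refl)
  ultimately have "{pi0_class (map_space X z y) (frac X mu f' g') |f' g'. f' \<in> ?F \<and> g' \<in> ?G} =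
      {pi0_class (map_space X z y) (frac X mu f g)}"
    by blast
  then show ?thesis by (simp add: Ho_frac_def)
qed

lemma unit_vertex_in:
  assumes x: "x \<in> bcells X 0 0" shows "unit_vertex X x \<in> cells (map_space X x x) 0"
  using hdegen_in[OF x, of 0] hface_hdegen_id[OF x, of 0 0] hface_hdegen_id[OF x, of 0 1]
  by (simp add: map_space_0[OF x x] unit_vertex_def)

lemma Ho_comp_class:
  assumes x: "x \<in> bcells X 0 0" and y: "y \<in> bcells X 0 0" and z: "z \<in> bcells X 0 0"
    and g: "g \<in> cells (map_space X y z) 0" and f: "f \<in> cells (map_space X x y) 0"
  shows "Ho_comp X mu x y z (pi0_class (map_space X y z) g) (pi0_class (map_space X x y) f) =
    pi0_class (map_space X x z) (frac X mu g (frac X mu (unit_vertex X x) f))"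
  using x y z g f unit_vertex_in[OF x] frac_in_map_space[OF X mu unit_vertex_in[OF x] f]
  by (simp add: Ho_comp_def Ho_frac_class)

lemma groupoid_Ho_B: "groupoid (bcells X 0 0) (Ho_B X) (Ho_comp X mu)"
proof -
  let ?u = "\<lambda>x. pi0_class (map_space X x x) (unit_vertex X x)"
  have "groupoid (bcells X 0 0) (Ho_B X)
      (\<lambda>x y z g f. Ho_frac X mu y z x g (Ho_frac X mu x x y (?u x) f))"
  proof (rule groupoid_of_fractions)
    show "?u x \<in> Ho_B X x x" if "x \<in> bcells X 0 0" for x
      using that by (simp add: pi0_class_in unit_vertex_in)
  next
    fix x y z F G
    assume xyz: "x \<in> bcells X 0 0" "y \<in> bcells X 0 0" "z \<in> bcells X 0 0"
      and "F \<in> Ho_B X x y" "G \<in> Ho_B X x z"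
    then obtain f g where fg: "f \<in> cells (map_space X x y) 0" "g \<in> cells (map_space X x z) 0"
      "F = pi0_class (map_space X x y) f" "G = pi0_class (map_space X x z) g"
      by (metis Ho_B_cases)
    then show "Ho_frac X mu x y z F G \<in> Ho_B X z y"
      using xyz by (simp add: Ho_frac_class pi0_class_in frac_in_map_space[OF X mu])
  next
    fix x y F
    assume xy: "x \<in> bcells X 0 0" "y \<in> bcells X 0 0" and F: "F \<in> Ho_B X x y"
    obtain f where f: "f \<in> cells (map_space X x y) 0" "F = pi0_class (map_space X x y) f"
      using Ho_B_cases[OF F] .
    have f0: "f \<in> bcells X 1 0" "hface X 1 1 0 f = x" "hface X 1 0 0 f = y"
      using f(1) by (simp_all add: map_space_0[OF xy])
    note fu = frac_in_map_space[OF X mu f(1) unit_vertex_in[OF xy(1)]] and ff = frac_in_map_space[OF X mu f(1) f(1)]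
    show "Ho_frac X mu x y x F (?u x) = F"
      using Ho_frac_class[OF xy xy(1) f(1) unit_vertex_in[OF xy(1)]] pi0_class_eqI[OF xy fu f(1)]
        fraction_unit[OF f0(1)] by (simp add: f(2) f0(2) frac_eq)
    show "Ho_frac X mu x y y F F = ?u y"
      using Ho_frac_class[OF xy xy(2) f(1) f(1)] pi0_class_eqI[OF xy(2) xy(2) ff unit_vertex_in[OF xy(2)]]
        fraction_self[OF f0(1)] by (simp add: f(2) f0(3) frac_eq)
  next
    fix w x y z F G H
    assume ob: "w \<in> bcells X 0 0" "x \<in> bcells X 0 0" "y \<in> bcells X 0 0" "z \<in> bcells X 0 0"
      and "F \<in> Ho_B X w x" "G \<in> Ho_B X w y" "H \<in> Ho_B X w z"
    then obtain f g h where fgh: "f \<in> cells (map_space X w x) 0" "g \<in> cells (map_space X w y) 0"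
        "h \<in> cells (map_space X w z) 0"
      and FGH: "F = pi0_class (map_space X w x) f" "G = pi0_class (map_space X w y) g" "H = pi0_class (map_space X w z) h"
      by (metis Ho_B_cases)
    note fr = frac_in_map_space[OF X mu]
    have "frac X mu (frac X mu f h) (frac X mu g h) \<simeq> frac X mu f g"
      unfolding frac_eq using ob fgh by (intro fraction_fractions) (blast intro: map_space_divisible)+
    from pi0_class_eqI[OF ob(3,2) fr[OF fr[OF fgh(1,3)] fr[OF fgh(2,3)]] fr[OF fgh(1,2)] this]
    show "Ho_frac X mu z x y (Ho_frac X mu w x z F H) (Ho_frac X mu w y z G H) = Ho_frac X mu w x y F G"
      using ob fgh fr by (simp add: FGH Ho_frac_class)
  qed
  moreover have "Ho_comp X mu = (\<lambda>x y z g f. Ho_frac X mu y z x g (Ho_frac X mu x x y (?u x) f))"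
    by (intro ext) (rule Ho_comp_def)
  ultimately show ?thesis by simp
qed

end

theorem corollary3p4:
  fixes X :: "'a bisset" and mu :: "nat \<Rightarrow> 'a \<times> 'a \<Rightarrow> 'a"
  assumes "bousfield_segal_space X"
    and "bousfield_section X mu"
  shows "groupoid (bcells X 0 0) (Ho_B X) (Ho_comp X mu) \<and>
    (\<forall>x\<in>bcells X 0 0. \<forall>y\<in>bcells X 0 0. \<forall>z\<in>bcells X 0 0.
       \<forall>g\<in>cells (map_space X y z) 0. \<forall>f\<in>cells (map_space X x y) 0.
         Ho_comp X mu x y z (pi0_class (map_space X y z) g) (pi0_class (map_space X x y) f) =
         pi0_class (map_space X x z) (frac X mu g (frac X mu (unit_vertex X x) f)))"
proof -
  interpret bousfield_fractions X mu
    using assms by unfold_locales (simp_all add: bousfield_segal_space_def)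
  show ?thesis using groupoid_Ho_B Ho_comp_class by simp
qed

end
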